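(* Let $\mathbb{X}$ be a finite dimensional real inner product space with induced norm $\|\cdot\|$, and let $\Phi:\mathbb{X}\to(-\infty,\infty]$ be a proper lower semicontinuous function that is coercive and bounded below. Let $m\ge 0$ be an integer, $a>0$, $b>0$, and let $\{x^k\}_{k\in\mathbb{N}}\subset\mathbb{X}$ be a sequence such that for each $k\in\mathbb{N}$: (H1) $\Phi(x^{k+1})+a\|x^{k+1}-x^k\|^2\le\max_{j=[k-m]_+,\ldots,k}\Phi(x^j)$; (H2) there exists $w^k\in\partial\Phi(x^k)$ such that $\|w^{k+1}\|\le b\|x^{k+1}-x^k\|$. Let $\omega(x^0)$ be the set of cluster points of $\{x^k\}_{k\in\mathbb{N}}$. Suppose that $\Phi$ is a KL function associated to $\varphi(t)=ct^{1-\theta}$ with $\theta\in(0,1)$ and $c>0$, that $\liminf_{k\to\infty}\Phi(x^k)\ge\lim_{k\to\infty}\Phi(x^{\ell(k)})$, that $\limsup_{j\to\infty}\Phi(x^{k_j})\le\Phi(\widehat{x})$ for each subsequence $\{x^{k_j}\}_{j\in\mathbb{N}}$ with $\lim_{j\to\infty}x^{k_j}=\widehat{x}$, and that for some $\rho>0$ the function $\Phi$ is $\rho$-weakly convex on a neighborhood of $\omega(x^0)$. Let $\Phi^*:=\lim_{k\to\infty}\Phi(x^k)$ (this limit exists) and $$K_1:=\big\{k\in\mathbb{N}\,|\,\Phi(x^{\ell(k+1)})-\Phi(x^{k+1})\ge\tfrac{a}{2}\|x^{k+1}-x^k\|^2\big\},$$ $$K_2:=\big\{k\in\mathbb{N}\,|\,\tfrac{a}{2}\|x^{k+1}-x^k\|^2\le\Phi(x^{\ell(k+1)})-\Phi(x^{k+1})<\tfrac{a}{2}\|x^{k+1}-x^k\|^{\frac1\theta}\big\},$$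 $$K_{31}:=\big\{k\in K_1\setminus K_2\,|\,\Phi^*-\Phi(x^{k+1})>\tfrac{a}{4}\|x^{k+1}-x^k\|^{\frac1\theta}\big\}.$$ Then the following two statements are equivalent. (A) There exist $\widetilde{k}_0\in\mathbb{N}$, $\widetilde{\gamma}>0$ and $\widetilde{\tau}\in(0,1)$ such that for all $k\ge\widetilde{k}_0$ $$\sum_{j\in K_2\cup K_{31},\,j\ge k}\sqrt{\Phi(x^{\ell(j+1)})-\Phi(x^{j+1})}\le\begin{cases}\widetilde{\gamma}\,\widetilde{\tau}^k&\text{if }\theta\in(0,1/2],\\ \widetilde{\gamma}\,k^{\frac{1-\theta}{1-2\theta}}&\text{if }\theta\in(1/2,1).\end{cases}$$ (B) The sequence $\{x^k\}_{k\in\mathbb{N}}$ converges to a point $\widetilde{x}\in\omega(x^0)$ and there exist $\gamma>0$ and $\varrho\in(0,1)$ such that for all sufficiently large $k$, $$\|x^k-\widetilde{x}\|\le\sum_{j=k}^\infty\|x^{j+1}-x^j\|\le\begin{cases}\gamma\varrho^k&\text{if }\theta\in(0,1/2],\\ \gamma k^{\frac{1-\theta}{1-2\theta}}&\text{if }\theta\in(1/2,1).\end{cases}$$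
   Context: $[t]_+:=\max(0,t)$. For each $k$, $\ell(k)$ denotes the largest index in $\arg\max_{j=[k-m]_+,\ldots,k}\Phi(x^j)$ (under (H1), $\{\Phi(x^{\ell(k)})\}$ is nonincreasing, so its limit exists). $\partial\Phi$ denotes the limiting (Mordukhovich) subdifferential; it is considered only at points of $\mathrm{dom}\,\Phi$. $\Phi$ is $\rho$-weakly convex on a set $\mathcal{N}$ if $x\mapsto\Phi(x)+\frac{\rho}{2}\|x\|^2$ is convex on $\mathcal{N}$, i.e. satisfies the convexity inequality along every line segment contained in $\mathcal{N}$. "$\Phi$ is a KL function associated to $\varphi(t)=ct^{1-\theta}$" means: for every $\overline{x}\in\mathrm{dom}\,\partial\Phi$ there exist $\eta\in(0,\infty]$ and a neighborhood $\mathcal{U}$ of $\overline{x}$ such that $\varphi'(\Phi(x)-\Phi(\overline{x}))\,\mathrm{dist}(0,\partial\Phi(x))\ge1$ for all $x\in\mathcal{U}$ with $\Phi(\overline{x})<\Phi(x)<\Phi(\overline{x})+\eta$. *)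

theory Defs
  imports "HOL-Analysis.Analysis"
begin

section \<open>Extended-real-valued functions\<close>

definition edom :: "('a \<Rightarrow> ereal) \<Rightarrow> 'a set" where
  "edom f = {x. f x < \<infinity>}"

definition proper_fun :: "('a \<Rightarrow> ereal) \<Rightarrow> bool" where
  "proper_fun f \<longleftrightarrow> (\<forall>x. f x \<noteq> -\<infinity>) \<and> edom f \<noteq> {}"

definition lower_semicont :: "('a::topological_space \<Rightarrow> ereal) \<Rightarrow> bool" where
  "lower_semicont f \<longleftrightarrow> (\<forall>x. f x \<le> Liminf (at x) f)"

definition coercive :: "('a::real_normed_vector \<Rightarrow> ereal) \<Rightarrow> bool" where
  "coercive f \<longleftrightarrow> (f \<longlongrightarrow> \<infinity>) at_infinity"

definition bounded_below_fun :: "('a \<Rightarrow> ereal) \<Rightarrow> bool" where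
  "bounded_below_fun f \<longleftrightarrow> (\<exists>r::real. \<forall>x. ereal r \<le> f x)"

text \<open>
  No convexity of the set is required: the inequality is imposed on the segments contained in it.
  At the end points of a segment it is trivial, since \<open>0 * \<infinity> = 0\<close> in the extended reals.
\<close>
definition convex_along_segments :: "'a::real_vector set \<Rightarrow> ('a \<Rightarrow> ereal) \<Rightarrow> bool" where
  "convex_along_segments N f \<longleftrightarrow>
     (\<forall>x y. closed_segment x y \<subseteq> N \<longrightarrow>
        (\<forall>t\<in>{0..1::real}. f ((1 - t) *\<^sub>R x + t *\<^sub>R y) \<le> ereal (1 - t) * f x + ereal t * f y))"

definition weakly_convex_on :: "real \<Rightarrow> 'a::real_normed_vector set \<Rightarrow> ('a \<Rightarrow> ereal) \<Rightarrow> bool" where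
  "weakly_convex_on \<rho> N f \<longleftrightarrow> convex_along_segments N (\<lambda>x. f x + ereal (\<rho> / 2 * (norm x)\<^sup>2))"

section \<open>Subdifferentials\<close>

definition frechet_subdiff :: "('a::real_inner \<Rightarrow> ereal) \<Rightarrow> 'a \<Rightarrow> 'a set" where
  "frechet_subdiff f x =
     {v. x \<in> edom f \<and>
         0 \<le> Liminf (at x) (\<lambda>y. (f y - f x - ereal (v \<bullet> (y - x))) / ereal (norm (y - x)))}"

definition limiting_subdiff :: "('a::real_inner \<Rightarrow> ereal) \<Rightarrow> 'a \<Rightarrow> 'a set" where
  "limiting_subdiff f x =
     {v. x \<in> edom f \<and>
         (\<exists>y u. y \<longlonglongrightarrow> x \<and> (\<lambda>n. f (y n)) \<longlonglongrightarrow> f x \<and>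
                (\<forall>n. u n \<in> frechet_subdiff f (y n)) \<and> u \<longlonglongrightarrow> v)}"

text \<open>
  The distance to the empty set is \<open>\<infinity>\<close> here (whereas \<^const>\<open>infdist\<close> to the empty set is 0),
  so that the KL inequality holds at points without subgradients.
\<close>
definition edist_zero :: "'a::real_normed_vector set \<Rightarrow> ereal" where
  "edist_zero S = (INF v\<in>S. ereal (norm v))"

definition KL_function :: "('a::real_inner \<Rightarrow> ereal) \<Rightarrow> (real \<Rightarrow> real) \<Rightarrow> bool" where
  "KL_function f \<phi> \<longleftrightarrow>
     (\<forall>z. limiting_subdiff f z \<noteq> {} \<longrightarrow>
        (\<exists>\<eta>::ereal. \<exists>U. 0 < \<eta> \<and> z \<in> interior U \<and>
           (\<forall>x\<in>U. f z < f x \<and> f x < f z + \<eta> \<longrightarrow>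
              1 \<le> ereal (deriv \<phi> (real_of_ereal (f x - f z))) * edist_zero (limiting_subdiff f x))))"

section \<open>Sequences\<close>

definition cluster_points :: "(nat \<Rightarrow> 'a::topological_space) \<Rightarrow> 'a set" where
  "cluster_points x = {z. \<exists>r. strict_mono r \<and> (x \<circ> r) \<longlonglongrightarrow> z}"

text \<open>Truncated subtraction on \<^typ>\<open>nat\<close> is the positive part \<open>[k - m]\<^sub>+\<close>.\<close>
definition last_argmax :: "('a \<Rightarrow> ereal) \<Rightarrow> (nat \<Rightarrow> 'a) \<Rightarrow> nat \<Rightarrow> nat \<Rightarrow> nat" where
  "last_argmax f x m k = Max {j\<in>{k - m..k}. \<forall>i\<in>{k - m..k}. f (x i) \<le> f (x j)}"

text \<open>
  For \<open>\<theta> > 1/2\<close> the exponent is negative and the value at \<open>k = 0\<close> is meaningless (HOL gives 0);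
  bounds by this rate are only used for all sufficiently large \<open>k\<close>.
\<close>
definition KL_rate :: "real \<Rightarrow> real \<Rightarrow> real \<Rightarrow> nat \<Rightarrow> real" where
  "KL_rate \<theta> \<gamma> \<tau> k =
     (if \<theta> \<le> 1/2 then \<gamma> * \<tau> ^ k else \<gamma> * real k powr ((1 - \<theta>) / (1 - 2 * \<theta>)))"

end

theory Submission
  imports Defs
begin

text \<open>
  Write \<open>F k = \<Phi> (x k)\<close>, \<open>M k = \<Phi> (x (l k))\<close>, \<open>d k = norm (x (k + 1) - x k)\<close> and \<open>r = M - \<Phi>\<^sup>*\<close>.
  Applying the KL inequality at \<open>x (l (k + m + 1))\<close> and inserting (H2) and (H1) gives
  \<open>r (k + m + 1) powr (2 * \<theta>) \<le> C * (r k - r (k + m + 1))\<close>, which yields both the rate of \<open>r\<close> and,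
  by a telescoping argument, a bound on the tail sums of \<open>r powr \<theta>\<close>.

  For (A) \<open>\<Longrightarrow>\<close> (B), a step outside \<open>K1\<close> satisfies \<open>a / 2 * (d k)\<^sup>2 \<le> r k - r (k + 1)\<close>, a step in
  \<open>K1 - (K2 \<union> K31)\<close> satisfies \<open>a / 4 * d k powr (1 / \<theta>) \<le> r (k + 1)\<close>, and the remaining steps are
  bounded by the summands of (A).

  For (B) \<open>\<Longrightarrow>\<close> (A), weak convexity and (H2) give \<open>F i - F (i + 1) \<le> C * (d (i - 1) + d i)\<^sup>2\<close>, hence
  \<open>sqrt (M (j + 1) - F (j + 1))\<close> is at most a constant times the sum of the last \<open>m + 2\<close> step lengths.

  Uniformity of the KL inequality and of weak convexity along the sequence is obtained by passing to
  convergent subsequences of a hypothetical sequence of violating indices.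
\<close>

section \<open>A power-type recursion\<close>

text \<open>Concavity of the power function as weighted AM-GM: convexity of \<open>exp\<close> is
  applied to the points 0 and \<open>ln t\<close>. The case \<open>t = 0\<close> is separate because
  there \<open>t\<close> is not \<open>exp (ln t)\<close>.\<close>

lemma powr_le_tangent_at_1:
  fixes t \<beta> :: real
  assumes "0 \<le> t" "0 \<le> \<beta>" "\<beta> \<le> 1"
  shows "t powr \<beta> \<le> 1 + \<beta> * (t - 1)"
proof (cases "t = 0")
  case True
  then show ?thesis using assms by simp
next
  case False
  then have t: "0 < t" using assms by simp
  have "exp ((1 - \<beta>) *\<^sub>R 0 + \<beta> *\<^sub>R ln t) \<le> (1 - \<beta>) * exp 0 + \<beta> * exp (ln t)"
    by (rule convex_onD[OF exp_convex]) (use assms in auto)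
  then show ?thesis using t by (simp add: powr_def algebra_simps)
qed

text \<open>The right-hand side telescopes along a nonincreasing sequence; together with Young's inequality this
  bounds sums of \<open>sqrt (r\<^sub>j - r\<^sub>j\<^sub>+\<^sub>1)\<close>.\<close>

lemma diff_mult_powr_le:
  fixes u v \<theta> :: real
  assumes "0 \<le> u" "u \<le> v" "0 < v" "0 < \<theta>" "\<theta> < 1"
  shows "(v - u) * v powr (-\<theta>) \<le> (v powr (1 - \<theta>) - u powr (1 - \<theta>)) / (1 - \<theta>)"
proof -
  have "(u / v) powr (1 - \<theta>) \<le> 1 + (1 - \<theta>) * (u / v - 1)"
    by (rule powr_le_tangent_at_1) (use assms in auto)
  then have "v powr (1 - \<theta>) * (u / v) powr (1 - \<theta>) \<le> v powr (1 - \<theta>) * (1 + (1 - \<theta>) * (u / v - 1))"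
    by (rule mult_left_mono) simp
  moreover have "v powr (1 - \<theta>) * (u / v) powr (1 - \<theta>) = u powr (1 - \<theta>)"
    using assms by (simp add: powr_divide)
  moreover have "v powr (1 - \<theta>) * (1 + (1 - \<theta>) * (u / v - 1)) =
      v powr (1 - \<theta>) - (1 - \<theta>) * ((v - u) * v powr (-\<theta>))"
  proof -
    have "v powr (1 - \<theta>) = v * v powr (-\<theta>)"
      using assms powr_add[of v 1 "-\<theta>"] by simp
    then have "v powr (1 - \<theta>) * (u / v - 1) = - ((v - u) * v powr (-\<theta>))"
      using assms by (simp add: left_diff_distrib right_diff_distrib)
    moreover have "A * (1 + (1 - \<theta>) * X) = A + (1 - \<theta>) * (A * X)" for A X
      by (simp add: algebra_simps)
    ultimately show ?thesis by simp
  qed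
  ultimately have "u powr (1 - \<theta>) \<le> v powr (1 - \<theta>) - (1 - \<theta>) * ((v - u) * v powr (-\<theta>))"
    by simp
  then show ?thesis using assms by (simp add: field_simps)
qed

text \<open>Young's inequality: \<open>v - u = 4 * A * B\<close> forces
  \<open>sqrt (v - u) \<le> A + B\<close>, and \<open>B\<close> is controlled by the telescoping
  bound above. The free weight \<open>\<epsilon>\<close> allows the first term to be made small
  enough for absorption.\<close>

lemma sqrt_diff_le:
  fixes u v \<theta> \<epsilon> :: real
  assumes "0 \<le> u" "u \<le> v" "0 < \<theta>" "\<theta> < 1" "0 < \<epsilon>"
  shows "sqrt (v - u) \<le> \<epsilon> * v powr \<theta> + (v powr (1 - \<theta>) - u powr (1 - \<theta>)) / (4 * \<epsilon> * (1 - \<theta>))"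
proof (cases "v = 0")
  case True
  then show ?thesis using assms by simp
next
  case False
  then have v: "0 < v" using assms by simp
  define A where "A = \<epsilon> * v powr \<theta>"
  define B where "B = (v - u) * v powr (-\<theta>) / (4 * \<epsilon>)"
  have nn: "0 \<le> A" "0 \<le> B" using assms by (auto simp: A_def B_def)
  have "4 * (A * B) = (v - u) * (v powr \<theta> * v powr (-\<theta>))"
    using assms by (simp add: A_def B_def)
  also have "\<dots> = v - u" using v by (simp add: powr_minus)
  finally have AB: "4 * (A * B) = v - u" .
  have "0 \<le> (A - B)\<^sup>2" by simp
  then have "v - u \<le> (A + B)\<^sup>2"
    using AB by (simp add: power2_eq_square algebra_simps)
  then have "sqrt (v - u) \<le> A + B"
    using nn by (intro real_le_lsqrt) auto
  moreover have "B \<le> (v powr (1 - \<theta>) - u powr (1 - \<theta>)) / (1 - \<theta>) / (4 * \<epsilon>)"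
    unfolding B_def using diff_mult_powr_le[OF assms(1,2) v assms(3,4)] assms
    by (intro divide_right_mono) auto
  ultimately show ?thesis by (simp add: A_def mult_ac)
qed

text \<open>Extending the first sum to \<open>q + n\<close> terms only increases it, since
  \<open>h\<close> is nonnegative; then its first \<open>q\<close> terms are all that survives the
  subtraction.\<close>

lemma sum_minus_shift_le:
  fixes h :: "nat \<Rightarrow> real"
  assumes "\<And>i. 0 \<le> h i" "\<And>i. h i \<le> h 0"
  shows "(\<Sum>j<n. h j) - (\<Sum>j<n. h (j + q)) \<le> real q * h 0"
proof -
  have "(\<Sum>j<n. h j) \<le> (\<Sum>j<q + n. h j)"
    by (rule sum_mono2) (use assms in auto)
  also have "\<dots> = (\<Sum>j<q. h j) + (\<Sum>j<n. h (j + q))"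
    by (induction n) (auto simp: add.commute)
  also have "(\<Sum>j<q. h j) \<le> (\<Sum>j<q. h 0)"
    by (rule sum_mono) (use assms in auto)
  finally show ?thesis by simp
qed

text \<open>Square roots of the recursion and Young's inequality bound
  \<open>r (k + q) powr \<theta>\<close> by half of \<open>r k powr \<theta>\<close> plus a
  telescoping term. After summation the half is absorbed on the left, and the shift by
  \<open>q\<close> costs only \<open>q\<close> initial terms.\<close>

lemma powr_sum_bound:
  fixes r :: "nat \<Rightarrow> real"
  assumes dec: "decseq r" and nn: "\<And>k. 0 \<le> r k"
    and \<theta>: "0 < \<theta>" "\<theta> < 1" and C: "0 < C"
    and rec: "\<And>k. k \<ge> K \<Longrightarrow> r (k + q) powr (2 * \<theta>) \<le> C * (r k - r (k + q))"
  shows "\<exists>D>0. \<forall>k\<ge>K. \<forall>n. (\<Sum>j<n. r (k + j) powr \<theta>) \<le> D * (r k powr \<theta> + r k powr (1 - \<theta>))"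
proof -
  define E where "E = C / (2 * (1 - \<theta>))"
  define D where "D = 2 * (real q + 1) * (1 + E)"
  have E: "0 < E" using \<theta> C by (simp add: E_def)
  have D: "0 < D" using E by (simp add: D_def)
  have step: "r (k + q) powr \<theta> \<le> 1/2 * r k powr \<theta> + E * (r k powr (1 - \<theta>) - r (k + q) powr (1 - \<theta>))"
    if k: "k \<ge> K" for k
  proof -
    have le: "r (k + q) \<le> r k" using dec by (simp add: decseq_def)
    \<comment> \<open>This weight makes the coefficient \<open>sqrt C * \<epsilon>\<close> equal to
      1/2.\<close>
    define \<epsilon> where "\<epsilon> = 1 / (2 * sqrt C)"
    have \<epsilon>: "0 < \<epsilon>" using C by (simp add: \<epsilon>_def)
    have "(r (k + q) powr \<theta>)\<^sup>2 = r (k + q) powr (2 * \<theta>)"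
      by (simp add: power2_eq_square flip: powr_add)
    then have "r (k + q) powr \<theta> \<le> sqrt (C * (r k - r (k + q)))"
      using rec[OF k] by (intro real_le_rsqrt) simp
    also have "\<dots> = sqrt C * sqrt (r k - r (k + q))" by (simp add: real_sqrt_mult)
    also have "\<dots> \<le> sqrt C * (\<epsilon> * r k powr \<theta> +
        (r k powr (1 - \<theta>) - r (k + q) powr (1 - \<theta>)) / (4 * \<epsilon> * (1 - \<theta>)))"
      by (intro mult_left_mono sqrt_diff_le) (use nn le \<theta> \<epsilon> C in auto)
    also have "\<dots> = 1/2 * r k powr \<theta> + E * (r k powr (1 - \<theta>) - r (k + q) powr (1 - \<theta>))"
    proof -
      have "sqrt C * \<epsilon> = 1/2" using C by (simp add: \<epsilon>_def)
      moreover have "sqrt C / (4 * \<epsilon> * (1 - \<theta>)) = E"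
        using C \<theta> by (simp add: \<epsilon>_def E_def field_simps)
      moreover have "sqrt C * (\<epsilon> * P + Q / (4 * \<epsilon> * (1 - \<theta>))) = (sqrt C * \<epsilon>) * P + (sqrt C / (4 * \<epsilon> * (1 - \<theta>))) * Q" for P Q
        by (simp add: algebra_simps)
      ultimately show ?thesis by simp
    qed
    finally show ?thesis .
  qed
  have "(\<Sum>j<n. r (k + j) powr \<theta>) \<le> D * (r k powr \<theta> + r k powr (1 - \<theta>))" if k: "k \<ge> K" for k n
  proof -
    define g h where "g = (\<lambda>j. r (k + j) powr \<theta>)" and "h = (\<lambda>j. r (k + j) powr (1 - \<theta>))"
    have rle: "r (k + i) \<le> r k" for i using dec by (simp add: decseq_def)
    have g: "0 \<le> g i" "g i \<le> g 0" and h: "0 \<le> h i" "h i \<le> h 0" for i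
      using rle nn \<theta> by (auto simp: g_def h_def intro!: powr_mono2)
    have "(\<Sum>j<n. g (j + q)) \<le> (\<Sum>j<n. 1/2 * g j + E * (h j - h (j + q)))"
      by (rule sum_mono) (use step[of "k + _"] k in \<open>auto simp: g_def h_def add_ac\<close>)
    also have "\<dots> = 1/2 * (\<Sum>j<n. g j) + E * ((\<Sum>j<n. h j) - (\<Sum>j<n. h (j + q)))"
      by (simp add: sum.distrib sum_subtractf sum_distrib_left right_diff_distrib sum_divide_distrib)
    also have "\<dots> \<le> 1/2 * (\<Sum>j<n. g j) + E * (real q * h 0)"
      using sum_minus_shift_le[of h, OF h] E by (intro add_left_mono mult_left_mono) auto
    \<comment> \<open>The shifted sum is at least the full sum minus \<open>q * g 0\<close>;
      subtracting half of the full sum completes the absorption.\<close>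
    finally have "(\<Sum>j<n. g j) \<le> 2 * (real q * g 0 + E * (real q * h 0))"
      using sum_minus_shift_le[of g n q, OF g] by simp
    also have "\<dots> \<le> D * (g 0 + h 0)"
    proof -
      have "0 \<le> g 0 * (2 + E * 2 + real q * E * 2)" "0 \<le> h 0 * (2 + E * 2 + real q * 2)"
        using g h E by (auto intro!: mult_nonneg_nonneg add_nonneg_nonneg)
      then show ?thesis by (simp add: D_def algebra_simps)
    qed
    finally show ?thesis by (simp add: g_def h_def)
  qed
  then show ?thesis using D by blast
qed

section \<open>Decay at the KL rate\<close>

text \<open>The constants are quantified inside the predicate and only large indices count, so it is
  stable under majorization, sums, positive multiples and index shifts. The rates in both statements
  of the theorem take this form.\<close>

definition KL_decay :: "real \<Rightarrow> (nat \<Rightarrow> real) \<Rightarrow> bool" where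
  "KL_decay \<theta> s \<longleftrightarrow>
     (\<exists>\<gamma>>0. \<exists>\<tau>. 0 < \<tau> \<and> \<tau> < 1 \<and> (\<forall>\<^sub>F k in sequentially. s k \<le> KL_rate \<theta> \<gamma> \<tau> k))"

lemma KL_decayI:
  assumes "0 < \<gamma>" "0 < \<tau>" "\<tau> < 1" "\<forall>\<^sub>F k in sequentially. s k \<le> KL_rate \<theta> \<gamma> \<tau> k"
  shows "KL_decay \<theta> s"
  using assms unfolding KL_decay_def by blast

lemma KL_decay_mono:
  assumes "KL_decay \<theta> t" "\<forall>\<^sub>F k in sequentially. s k \<le> t k"
  shows "KL_decay \<theta> s"
proof -
  obtain \<gamma> \<tau> where \<gamma>: "0 < \<gamma>" "0 < \<tau>" "\<tau> < 1"
    and ev: "\<forall>\<^sub>F k in sequentially. t k \<le> KL_rate \<theta> \<gamma> \<tau> k"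
    using assms(1) unfolding KL_decay_def by blast
  from ev assms(2) have "\<forall>\<^sub>F k in sequentially. s k \<le> KL_rate \<theta> \<gamma> \<tau> k"
    by eventually_elim simp
  with \<gamma> show ?thesis by (rule KL_decayI)
qed

lemma KL_rate_add_le:
  assumes "0 \<le> \<gamma>" "0 \<le> \<gamma>'" "0 \<le> \<tau>" "0 \<le> \<tau>'"
  shows "KL_rate \<theta> \<gamma> \<tau> k + KL_rate \<theta> \<gamma>' \<tau>' k \<le> KL_rate \<theta> (\<gamma> + \<gamma>') (max \<tau> \<tau>') k"
proof -
  have "\<gamma> * \<tau> ^ k \<le> \<gamma> * max \<tau> \<tau>' ^ k" "\<gamma>' * \<tau>' ^ k \<le> \<gamma>' * max \<tau> \<tau>' ^ k"
    using assms by (auto intro!: mult_left_mono power_mono)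
  then show ?thesis by (simp add: KL_rate_def distrib_right)
qed

lemma KL_decay_add:
  assumes "KL_decay \<theta> s" "KL_decay \<theta> t"
  shows "KL_decay \<theta> (\<lambda>k. s k + t k)"
proof -
  obtain \<gamma> \<tau> where \<gamma>: "0 < \<gamma>" "0 < \<tau>" "\<tau> < 1"
    and s: "\<forall>\<^sub>F k in sequentially. s k \<le> KL_rate \<theta> \<gamma> \<tau> k"
    using assms(1) unfolding KL_decay_def by blast
  obtain \<gamma>' \<tau>' where \<gamma>': "0 < \<gamma>'" "0 < \<tau>'" "\<tau>' < 1"
    and t: "\<forall>\<^sub>F k in sequentially. t k \<le> KL_rate \<theta> \<gamma>' \<tau>' k"
    using assms(2) unfolding KL_decay_def by blast
  show ?thesis
  proof (rule KL_decayI)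
    show "\<forall>\<^sub>F k in sequentially. s k + t k \<le> KL_rate \<theta> (\<gamma> + \<gamma>') (max \<tau> \<tau>') k"
      using s t
    proof eventually_elim
      case (elim k)
      then show ?case using KL_rate_add_le[of \<gamma> \<gamma>' \<tau> \<tau>' \<theta> k] \<gamma> \<gamma>' by linarith
    qed
  qed (use \<gamma> \<gamma>' in auto)
qed

lemma KL_decay_cmult:
  assumes "KL_decay \<theta> s" "0 < c"
  shows "KL_decay \<theta> (\<lambda>k. c * s k)"
proof -
  obtain \<gamma> \<tau> where \<gamma>: "0 < \<gamma>" "0 < \<tau>" "\<tau> < 1"
    and s: "\<forall>\<^sub>F k in sequentially. s k \<le> KL_rate \<theta> \<gamma> \<tau> k"
    using assms(1) unfolding KL_decay_def by blast
  show ?thesis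
  proof (rule KL_decayI)
    show "\<forall>\<^sub>F k in sequentially. c * s k \<le> KL_rate \<theta> (c * \<gamma>) \<tau> k"
      using s
    proof eventually_elim
      case (elim k)
      then have "c * s k \<le> c * KL_rate \<theta> \<gamma> \<tau> k" using assms(2) by (intro mult_left_mono) auto
      then show ?case by (simp add: KL_rate_def mult_ac split: if_splits)
    qed
  qed (use \<gamma> assms in auto)
qed

text \<open>For \<open>k \<ge> 2 * q\<close> the shifted index is at least \<open>k / 2\<close>, and
  the power is nonincreasing, so the shift costs a constant factor. At \<open>k = 0\<close> both
  sides are 0.\<close>

lemma powr_shift_le:
  assumes "p \<le> 0" "2 * q \<le> k"
  shows "real (k - q) powr p \<le> 2 powr (-p) * real k powr p"
proof (cases "k = 0")
  case False
  have "real (k - q) powr p \<le> (real k / 2) powr p"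
    by (rule powr_mono2') (use assms False in auto)
  also have "\<dots> = 2 powr (-p) * real k powr p"
    by (simp add: powr_divide powr_minus divide_simps)
  finally show ?thesis .
qed simp

lemma KL_decay_shift:
  assumes "KL_decay \<theta> s" "\<theta> < 1"
  shows "KL_decay \<theta> (\<lambda>k. s (k - q))"
proof -
  obtain \<gamma> \<tau> where \<gamma>: "0 < \<gamma>" "0 < \<tau>" "\<tau> < 1"
    and s: "\<forall>\<^sub>F k in sequentially. s k \<le> KL_rate \<theta> \<gamma> \<tau> k"
    using assms(1) unfolding KL_decay_def by blast
  define p where "p = (1 - \<theta>) / (1 - 2 * \<theta>)"
  define \<gamma>' where "\<gamma>' = \<gamma> * (if \<theta> \<le> 1/2 then (1 / \<tau>) ^ q else 2 powr (-p))"
  show ?thesis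
  proof (rule KL_decayI)
    show "0 < \<gamma>'" using \<gamma> by (simp add: \<gamma>'_def)
    have "\<forall>\<^sub>F k in sequentially. s (k - q) \<le> KL_rate \<theta> \<gamma> \<tau> (k - q)"
      using s by (simp add: eventually_sequentially) (meson le_diff_conv2 add_leE)
    with eventually_ge_at_top[of "2 * q"]
    show "\<forall>\<^sub>F k in sequentially. s (k - q) \<le> KL_rate \<theta> \<gamma>' \<tau> k"
    proof eventually_elim
      case (elim k)
      have "KL_rate \<theta> \<gamma> \<tau> (k - q) \<le> KL_rate \<theta> \<gamma>' \<tau> k"
      proof (cases "\<theta> \<le> 1/2")
        case True
        have "\<tau> ^ (k - q) = (1 / \<tau>) ^ q * \<tau> ^ k"
          using elim(1) \<gamma> by (simp add: power_diff field_simps)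
        then show ?thesis using True by (simp add: KL_rate_def \<gamma>'_def)
      next
        case False
        then have "p \<le> 0" using assms(2) by (simp add: p_def divide_nonneg_neg)
        from powr_shift_le[OF this elim(1)] False \<gamma> show ?thesis
          by (simp add: KL_rate_def \<gamma>'_def p_def)
      qed
      with elim(2) show ?case by simp
    qed
  qed (use \<gamma> in auto)
qed

text \<open>Locates \<open>k\<close> in a block of length \<open>q\<close> counted from
  \<open>K\<close>. A bound along every \<open>q\<close>-th index then passes to all indices by
  monotonicity.\<close>

lemma shifted_div_bounds:
  fixes k K q :: nat
  assumes "K \<le> k" "0 < q"
  shows "K + (k - K) div q * q \<le> k" "k \<le> (k - K) div q * q + (K + q)"
proof -
  have "k - K = (k - K) div q * q + (k - K) mod q" by simp
  moreover have "(k - K) mod q < q" using assms by simp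
  ultimately show "K + (k - K) div q * q \<le> k" "k \<le> (k - K) div q * q + (K + q)"
    using assms(1) by linarith+
qed

text \<open>Iteration along \<open>K + n * q\<close> gives the factor \<open>\<sigma> ^ n\<close>;
  monotonicity covers the indices in between. The base per single step is the \<open>q\<close>-th
  root of \<open>\<sigma>\<close>.\<close>

lemma geometric_decay:
  fixes r :: "nat \<Rightarrow> real"
  assumes dec: "decseq r" and nn: "\<And>k. 0 \<le> r k" and q: "0 < q"
    and \<sigma>: "0 < \<sigma>" "\<sigma> < 1" and rec: "\<And>k. k \<ge> K \<Longrightarrow> r (k + q) \<le> \<sigma> * r k"
  shows "\<exists>A>0. \<exists>\<tau>. 0 < \<tau> \<and> \<tau> < 1 \<and> (\<forall>k\<ge>K. r k \<le> A * \<tau> ^ k)"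
proof -
  define \<tau> where "\<tau> = \<sigma> powr (1 / real q)"
  have \<tau>: "0 < \<tau>" "\<tau> < 1" using \<sigma> q by (auto simp: \<tau>_def powr01_less_one)
  have \<tau>q: "\<tau> ^ q = \<sigma>" using \<sigma> q by (simp add: \<tau>_def powr_powr flip: powr_realpow)
  have it: "r (K + n * q) \<le> \<sigma> ^ n * r K" for n
  proof (induction n)
    case (Suc n)
    have "r (K + Suc n * q) \<le> \<sigma> * r (K + n * q)"
      using rec[of "K + n * q"] by (simp add: add_ac)
    also have "\<dots> \<le> \<sigma> * (\<sigma> ^ n * r K)" using Suc \<sigma> by simp
    finally show ?case by (simp add: mult_ac)
  qed simp
  \<comment> \<open>The power of \<open>1 / \<tau>\<close> pays for the offset of at most
    \<open>K + q\<close> between \<open>k\<close> and \<open>n * q\<close>; adding 1 keeps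
    \<open>A\<close> positive when \<open>r K = 0\<close>.\<close>
  define A where "A = (r K + 1) * (1 / \<tau>) ^ (K + q)"
  have "r k \<le> A * \<tau> ^ k" if k: "k \<ge> K" for k
  proof -
    define n where "n = (k - K) div q"
    note n = shifted_div_bounds[OF _ q, of K k, folded n_def]
    have n1: "K + n * q \<le> k" and n2: "k \<le> n * q + (K + q)" using n k by auto
    have "r k \<le> r (K + n * q)" using dec n1 by (simp add: decseq_def)
    also have "\<dots> \<le> \<sigma> ^ n * r K" by (rule it)
    also have "\<dots> \<le> \<tau> ^ (n * q) * (r K + 1)"
      using \<sigma> by (simp add: mult.commute[of n] power_mult \<tau>q)
    also have "\<tau> ^ (n * q) = \<tau> ^ (n * q + (K + q)) * (1 / \<tau>) ^ (K + q)"
      using \<tau> by (simp add: power_add power_one_over)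
    also have "\<dots> \<le> \<tau> ^ k * (1 / \<tau>) ^ (K + q)"
      using n2 \<tau> by (intro mult_right_mono power_decreasing) auto
    finally show ?thesis using nn[of K] by (simp add: A_def mult_ac)
  qed
  moreover have "0 < A" using nn[of K] \<tau> by (simp add: A_def add_nonneg_pos)
  ultimately show ?thesis using \<tau> by blast
qed

text \<open>Discrete form of the fact that solutions of
  \<open>y' = - y powr (1 + \<beta>) / C\<close> have \<open>y powr (-\<beta>)\<close> growing
  linearly. The recursion bounds the relative decrease \<open>z = 1 - u / v\<close> from below, and
  this enters the tangent inequality for \<open>(u / v) powr \<beta>\<close>.\<close>

lemma powr_minus_increment:
  fixes u v \<beta> C :: real
  assumes "0 < u" "u \<le> 1" "0 < \<beta>" "\<beta> < 1" "0 < C" and rec: "u powr (1 + \<beta>) \<le> C * (v - u)"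
  shows "v powr (-\<beta>) + \<beta> / (C + 1) \<le> u powr (-\<beta>)"
proof -
  have "0 < C * (v - u)" using less_le_trans[OF _ rec] assms(1) by simp
  then have uv: "u < v" using assms(5) by (simp add: zero_less_mult_iff)
  define z where "z = 1 - u / v"
  have ub: "0 < u powr \<beta>" "u powr \<beta> \<le> 1" using assms by (auto simp: powr_le1)
  have z: "u powr \<beta> / (C + 1) \<le> z"
  proof -
    have e: "u * u powr \<beta> \<le> C * (v - u)" using rec assms(1) by (simp add: powr_add)
    \<comment> \<open>Replacing \<open>u\<close> by \<open>v\<close> as the factor of
      \<open>u powr \<beta>\<close> costs one more \<open>v - u\<close>, because
      \<open>u \<le> 1\<close>; hence the constant \<open>C + 1\<close>.\<close>
    have "u powr \<beta> * (v - u) \<le> v - u" using ub uv by (simp add: mult_left_le_one_le)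
    with e have "u powr \<beta> * v \<le> (C + 1) * (v - u)" by (simp add: algebra_simps)
    then show ?thesis using assms uv by (simp add: z_def field_simps)
  qed
  have "(u / v) powr \<beta> \<le> 1 + \<beta> * (u / v - 1)"
    by (rule powr_le_tangent_at_1) (use assms uv in auto)
  also have "\<dots> = 1 - \<beta> * z" by (simp add: z_def algebra_simps)
  also have "\<dots> \<le> 1 - \<beta> * (u powr \<beta> / (C + 1))"
    using mult_left_mono[OF z, of \<beta>] assms by simp
  finally have "u powr (-\<beta>) * (u / v) powr \<beta> \<le> u powr (-\<beta>) * (1 - \<beta> * (u powr \<beta> / (C + 1)))"
    by (rule mult_left_mono) simp
  moreover have "u powr (-\<beta>) * (u / v) powr \<beta> = v powr (-\<beta>)"
    using assms uv by (simp add: powr_divide powr_minus field_simps)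
  moreover have "u powr (-\<beta>) * (1 - \<beta> * (u powr \<beta> / (C + 1))) = u powr (-\<beta>) - \<beta> / (C + 1)"
    using assms by (simp add: powr_minus field_simps)
  ultimately show ?thesis by linarith
qed

text \<open>Every \<open>q\<close> steps \<open>r powr (-\<beta>)\<close> grows by at least
  \<open>\<mu>\<close>, hence at least linearly; inverting the power gives the rate. The threshold
  \<open>2 * (K + q)\<close> ensures that the number \<open>n\<close> of complete blocks satisfies
  \<open>n * q \<ge> k / 2\<close>.\<close>

lemma polynomial_decay:
  fixes r :: "nat \<Rightarrow> real"
  assumes dec: "decseq r" and nn: "\<And>k. 0 \<le> r k" and q: "0 < q"
    and \<beta>: "0 < \<beta>" "\<beta> < 1" and C: "0 < C" and K: "r K \<le> 1"
    and rec: "\<And>k. k \<ge> K \<Longrightarrow> r (k + q) powr (1 + \<beta>) \<le> C * (r k - r (k + q))"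
  shows "\<exists>A>0. \<forall>k\<ge>2 * (K + q). r k \<le> A * real k powr (- 1 / \<beta>)"
proof -
  define \<mu> where "\<mu> = \<beta> / (C + 1)"
  have \<mu>: "0 < \<mu>" using \<beta> C by (simp add: \<mu>_def)
  \<comment> \<open>Positivity is required because \<open>0 powr (-\<beta>) = 0\<close> in HOL, so
    the bound would fail at a positive \<open>n\<close> once \<open>r\<close> has reached 0.\<close>
  have it: "real n * \<mu> \<le> r (K + n * q) powr (-\<beta>)" if "0 < r (K + n * q)" for n
    using that
  proof (induction n)
    case (Suc n)
    have eq: "K + Suc n * q = (K + n * q) + q" by simp
    have le: "r (K + Suc n * q) \<le> r (K + n * q)" "r (K + Suc n * q) \<le> r K"
      using dec by (simp_all add: decseq_def)
    have "r (K + n * q) powr (-\<beta>) + \<mu> \<le> r (K + Suc n * q) powr (-\<beta>)"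
      unfolding \<mu>_def
      by (rule powr_minus_increment) (use Suc.prems le \<beta> C K rec[of "K + n * q"] in \<open>auto simp: add_ac\<close>)
    moreover have "0 < r (K + n * q)" using Suc.prems le by linarith
    ultimately show ?case using Suc.IH by (simp add: algebra_simps)
  qed simp
  define A where "A = (\<mu> / (2 * real q)) powr (- 1 / \<beta>)"
  have A: "0 < A" using \<mu> q by (simp add: A_def)
  have "r k \<le> A * real k powr (- 1 / \<beta>)" if k: "k \<ge> 2 * (K + q)" for k
  proof (cases "r k = 0")
    case True
    then show ?thesis using A by simp
  next
    case False
    then have rk: "0 < r k" using nn[of k] by linarith
    define n where "n = (k - K) div q"
    note n = shifted_div_bounds[OF _ q, of K k, folded n_def]
    have n1: "K + n * q \<le> k" and n2: "k \<le> n * q + (K + q)" using n k by auto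
    have le: "r k \<le> r (K + n * q)" using dec n1 by (simp add: decseq_def)
    have "real k \<le> 2 * (real n * real q)"
    proof -
      have "k \<le> 2 * t" if "k \<le> t + (K + q)" for t using that k by simp
      from this[OF n2] have "k \<le> 2 * (n * q)" .
      then show ?thesis by (metis of_nat_le_iff of_nat_mult of_nat_numeral)
    qed
    then have "\<mu> * real k \<le> \<mu> * (2 * (real n * real q))"
      using \<mu> by (intro mult_left_mono) auto
    then have "\<mu> / (2 * real q) * real k \<le> real n * \<mu>"
      using q by (simp add: field_simps)
    also have "\<dots> \<le> r (K + n * q) powr (-\<beta>)" by (rule it) (use le rk in linarith)
    also have "\<dots> \<le> r k powr (-\<beta>)" by (rule powr_mono2') (use le rk \<beta> in auto)
    finally have *: "\<mu> / (2 * real q) * real k \<le> r k powr (-\<beta>)" .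
    have "r k = (r k powr (-\<beta>)) powr (- 1 / \<beta>)" using \<beta> rk by (simp add: powr_powr)
    also have "\<dots> \<le> (\<mu> / (2 * real q) * real k) powr (- 1 / \<beta>)"
      by (rule powr_mono2'[OF _ _ *]) (use \<beta> \<mu> q k in auto)
    also have "\<dots> = A * real k powr (- 1 / \<beta>)"
      unfolding A_def by (subst powr_mult) (use \<mu> q in auto)
    finally show ?thesis .
  qed
  then show ?thesis using A by blast
qed

text \<open>Once \<open>r < 1\<close>, the size of \<open>2 * \<theta>\<close> relative to 1
  decides: for \<open>\<theta> \<le> 1/2\<close> the recursion implies a linear contraction,
  otherwise it gives polynomial decay with \<open>\<beta> = 2 * \<theta> - 1\<close>. The smaller of
  the exponents \<open>\<theta>\<close> and \<open>1 - \<theta>\<close> governs the sum.\<close>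

lemma KL_decay_recursion:
  fixes r :: "nat \<Rightarrow> real"
  assumes dec: "decseq r" and lim: "r \<longlonglongrightarrow> 0" and q: "0 < q"
    and \<theta>: "0 < \<theta>" "\<theta> < 1" and C: "0 < C"
    and rec: "\<forall>\<^sub>F k in sequentially. r (k + q) powr (2 * \<theta>) \<le> C * (r k - r (k + q))"
  shows "KL_decay \<theta> (\<lambda>k. r k powr \<theta> + r k powr (1 - \<theta>))"
proof -
  have nn: "0 \<le> r k" for k using dec lim by (rule decseq_ge)
  have "\<forall>\<^sub>F k in sequentially. r k < 1" using lim by (rule order_tendstoD) simp
  with rec obtain K where K: "\<And>k. k \<ge> K \<Longrightarrow> r (k + q) powr (2 * \<theta>) \<le> C * (r k - r (k + q))"
      "\<And>k. k \<ge> K \<Longrightarrow> r k < 1"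
    by (auto simp: eventually_sequentially) (metis le_cases order_trans)
  show ?thesis
  proof (cases "\<theta> \<le> 1/2")
    case True
    have step: "r (k + q) \<le> C / (1 + C) * r k" if k: "k \<ge> K" for k
    proof -
      have "r (k + q) = r (k + q) powr 1" using nn by simp
      also have "\<dots> \<le> r (k + q) powr (2 * \<theta>)"
        by (rule powr_mono') (use True nn K(2)[of "k + q"] k \<theta> in auto)
      also have "\<dots> \<le> C * (r k - r (k + q))" by (rule K(1)[OF k])
      finally show ?thesis using C by (simp add: field_simps)
    qed
    have "\<exists>A>0. \<exists>\<tau>. 0 < \<tau> \<and> \<tau> < 1 \<and> (\<forall>k\<ge>K. r k \<le> A * \<tau> ^ k)"
      by (rule geometric_decay[OF dec nn q _ _ step]) (use C in auto)
    then obtain A \<tau> where A: "0 < A" "0 < \<tau>" "\<tau> < 1" "\<And>k. k \<ge> K \<Longrightarrow> r k \<le> A * \<tau> ^ k"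
      by blast
    show ?thesis
    proof (rule KL_decayI)
      show "\<forall>\<^sub>F k in sequentially. r k powr \<theta> + r k powr (1 - \<theta>) \<le> KL_rate \<theta> (2 * A powr \<theta>) (\<tau> powr \<theta>) k"
        using eventually_ge_at_top[of K]
      proof eventually_elim
        case (elim k)
        have "r k powr (1 - \<theta>) \<le> r k powr \<theta>"
          by (rule powr_mono') (use True nn K(2)[OF elim] \<theta> in auto)
        moreover have "r k powr \<theta> \<le> (A * \<tau> ^ k) powr \<theta>"
          by (rule powr_mono2) (use A(4)[OF elim] nn \<theta> in auto)
        moreover have "(A * \<tau> ^ k) powr \<theta> = A powr \<theta> * (\<tau> powr \<theta>) ^ k"
          using A by (simp add: powr_mult powr_powr mult.commute flip: powr_realpow)
        ultimately show ?case using True by (simp add: KL_rate_def)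
      qed
    qed (use A \<theta> in \<open>auto simp: powr01_less_one\<close>)
  next
    case False
    define \<beta> where "\<beta> = 2 * \<theta> - 1"
    have \<beta>: "0 < \<beta>" "\<beta> < 1" "1 + \<beta> = 2 * \<theta>" using False \<theta> by (auto simp: \<beta>_def)
    obtain A where A: "0 < A" "\<And>k. k \<ge> 2 * (K + q) \<Longrightarrow> r k \<le> A * real k powr (- 1 / \<beta>)"
      using polynomial_decay[OF dec nn q \<beta>(1,2) C, of K] K(1) K(2)[of K] \<beta>(3) by auto
    show ?thesis
    proof (rule KL_decayI)
      show "\<forall>\<^sub>F k in sequentially. r k powr \<theta> + r k powr (1 - \<theta>) \<le> KL_rate \<theta> (2 * A powr (1 - \<theta>)) (1/2) k"
        using eventually_ge_at_top[of "2 * (K + q)"]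
      proof eventually_elim
        case (elim k)
        have "r k powr \<theta> \<le> r k powr (1 - \<theta>)"
          by (rule powr_mono') (use False nn K(2)[of k] elim \<theta> in auto)
        moreover have "r k powr (1 - \<theta>) \<le> (A * real k powr (- 1 / \<beta>)) powr (1 - \<theta>)"
          by (rule powr_mono2) (use A(2)[OF elim] nn \<theta> in auto)
        moreover have "(A * real k powr (- 1 / \<beta>)) powr (1 - \<theta>)
            = A powr (1 - \<theta>) * real k powr ((1 - \<theta>) / (1 - 2 * \<theta>))"
        proof -
          have "- 1 / \<beta> * (1 - \<theta>) = (1 - \<theta>) / (1 - 2 * \<theta>)"
            using False by (simp add: \<beta>_def field_simps)
          then show ?thesis using A by (simp add: powr_mult powr_powr)
        qed
        ultimately show ?case using False by (simp add: KL_rate_def)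
      qed
    qed (use A \<theta> in auto)
  qed
qed

section \<open>Subgradients and weak convexity\<close>

text \<open>Keeping the function values as a component of the graph turns convergence with function
  values into ordinary convergence in a product space. Limits of limiting subgradients can then be
  taken by closedness of a closure instead of a diagonal argument.\<close>

lemma limiting_subdiff_eq_closure:
  "limiting_subdiff f z =
     {v. z \<in> edom f \<and> (z, f z, v) \<in> closure {(y, f y, u) | y u. u \<in> frechet_subdiff f y}}"
proof -
  let ?G = "{(y, f y, u) | y u. u \<in> frechet_subdiff f y}"
  have "(\<exists>y u. y \<longlonglongrightarrow> z \<and> (\<lambda>n. f (y n)) \<longlonglongrightarrow> f z \<and> (\<forall>n. u n \<in> frechet_subdiff f (y n)) \<and> u \<longlonglongrightarrow> v)
     \<longleftrightarrow> (z, f z, v) \<in> closure ?G" (is "?L = ?R") for v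
  proof
    assume ?L
    then obtain y u where yu: "y \<longlonglongrightarrow> z" "(\<lambda>n. f (y n)) \<longlonglongrightarrow> f z" "u \<longlonglongrightarrow> v"
      and u: "\<forall>n. u n \<in> frechet_subdiff f (y n)"
      by (elim exE conjE)
    have "(\<lambda>n. (y n, f (y n), u n)) \<longlonglongrightarrow> (z, f z, v)"
      by (intro tendsto_Pair yu)
    moreover have "\<forall>n. (y n, f (y n), u n) \<in> ?G" using u by simp
    ultimately show ?R unfolding closure_sequential by (intro exI conjI)
  next
    assume ?R
    then obtain w where w: "\<forall>n. w n \<in> ?G" "w \<longlonglongrightarrow> (z, f z, v)"
      unfolding closure_sequential by (elim exE conjE)
    define y u where "y = (\<lambda>n. fst (w n))" and "u = (\<lambda>n. snd (snd (w n)))"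
    have wn: "fst (snd (w n)) = f (y n) \<and> u n \<in> frechet_subdiff f (y n)" for n
      using w(1)[rule_format, of n] by (auto simp: y_def u_def)
    have "y \<longlonglongrightarrow> z" "(\<lambda>n. fst (snd (w n))) \<longlonglongrightarrow> f z" "u \<longlonglongrightarrow> v"
      using tendsto_fst[OF w(2)] tendsto_fst[OF tendsto_snd[OF w(2)]] tendsto_snd[OF tendsto_snd[OF w(2)]]
      by (simp_all add: y_def u_def)
    moreover have "(\<lambda>n. fst (snd (w n))) = (\<lambda>n. f (y n))" "\<forall>n. u n \<in> frechet_subdiff f (y n)"
      using wn by simp_all
    ultimately show ?L by (intro exI[of _ y] exI[of _ u]) simp
  qed
  then show ?thesis unfolding limiting_subdiff_def by (simp only:)
qed

text \<open>Outer semicontinuity along sequences with convergent function values. It makes 0 a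
  subgradient at every cluster point of the iterates.\<close>

lemma limiting_subdiff_limit:
  assumes v: "\<And>n. v n \<in> limiting_subdiff f (y n)"
    and lim: "y \<longlonglongrightarrow> z" "(\<lambda>n. f (y n)) \<longlonglongrightarrow> f z" "v \<longlonglongrightarrow> u" and z: "z \<in> edom f"
  shows "u \<in> limiting_subdiff f z"
proof -
  let ?G = "{(y, f y, u) | y u. u \<in> frechet_subdiff f y}"
  have "(\<lambda>n. (y n, f (y n), v n)) \<longlonglongrightarrow> (z, f z, u)"
    by (intro tendsto_Pair lim)
  moreover have "(y n, f (y n), v n) \<in> closure ?G" for n
    using v[of n] unfolding limiting_subdiff_eq_closure by blast
  ultimately have "(z, f z, u) \<in> closure ?G"
    by (meson closed_closure closed_sequentially)
  then show ?thesis using z unfolding limiting_subdiff_eq_closure by blast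
qed

text \<open>The last term is the exact convexity defect of the squared norm; it becomes the
  quadratic error in the inequality for weakly convex functions.\<close>

lemma norm_sq_convex_comb:
  fixes p y :: "'a::real_inner"
  shows "(norm ((1 - t) *\<^sub>R p + t *\<^sub>R y))\<^sup>2 =
    (1 - t) * (norm p)\<^sup>2 + t * (norm y)\<^sup>2 - t * (1 - t) * (norm (y - p))\<^sup>2"
proof -
  have 1: "((1 - t) *\<^sub>R p + t *\<^sub>R y) \<bullet> ((1 - t) *\<^sub>R p + t *\<^sub>R y)
      = (1 - t)\<^sup>2 * (p \<bullet> p) + 2 * t * (1 - t) * (p \<bullet> y) + t\<^sup>2 * (y \<bullet> y)"
    by (simp only: inner_add_left inner_add_right inner_scaleR_left inner_scaleR_right inner_commute[of y p])
      algebra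
  have 2: "(y - p) \<bullet> (y - p) = y \<bullet> y - 2 * (p \<bullet> y) + p \<bullet> p"
    by (simp add: inner_diff_left inner_diff_right inner_commute[of y p])
  show ?thesis
    unfolding power2_norm_eq_inner 1 2 by (simp add: power2_eq_square algebra_simps)
qed

lemma weakly_convex_on_real:
  fixes p y :: "'a::real_inner"
  assumes wc: "weakly_convex_on \<rho> N f" and seg: "closed_segment p y \<subseteq> N"
    and fp: "f p = ereal A" and fy: "f y = ereal B" and t: "0 \<le> t" "t \<le> 1"
  shows "f ((1 - t) *\<^sub>R p + t *\<^sub>R y) \<le> ereal ((1 - t) * A + t * B + \<rho> / 2 * t * (1 - t) * (norm (y - p))\<^sup>2)"
proof -
  let ?yt = "(1 - t) *\<^sub>R p + t *\<^sub>R y"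
  have "f ?yt + ereal (\<rho> / 2 * (norm ?yt)\<^sup>2) \<le>
      ereal (1 - t) * (f p + ereal (\<rho> / 2 * (norm p)\<^sup>2)) + ereal t * (f y + ereal (\<rho> / 2 * (norm y)\<^sup>2))"
    using wc seg t unfolding weakly_convex_on_def convex_along_segments_def by auto
  also have "\<dots> = ereal ((1 - t) * (A + \<rho> / 2 * (norm p)\<^sup>2) + t * (B + \<rho> / 2 * (norm y)\<^sup>2))"
    by (simp add: fp fy)
  finally have "f ?yt \<le> ereal ((1 - t) * (A + \<rho> / 2 * (norm p)\<^sup>2) + t * (B + \<rho> / 2 * (norm y)\<^sup>2)
      - \<rho> / 2 * (norm ?yt)\<^sup>2)"
    by (cases "f ?yt") auto
  also have "(1 - t) * (A + \<rho> / 2 * (norm p)\<^sup>2) + t * (B + \<rho> / 2 * (norm y)\<^sup>2) - \<rho> / 2 * (norm ?yt)\<^sup>2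
      = (1 - t) * A + t * B + \<rho> / 2 * t * (1 - t) * (norm (y - p))\<^sup>2"
  proof -
    have "(1 - t) * (A + h * P) + t * (B + h * Q) - h * ((1 - t) * P + t * Q - t * (1 - t) * D)
        = (1 - t) * A + t * B + h * t * (1 - t) * D" for h P Q D :: real
      by (simp add: algebra_simps)
    then show ?thesis unfolding norm_sq_convex_comb .
  qed
  finally show ?thesis .
qed

text \<open>The Frechet quotient is examined along the segment from \<open>p\<close> to
  \<open>y\<close>. Weak convexity bounds it from above and the subgradient property from below;
  cancelling the parameter \<open>t\<close> leaves the claim up to an arbitrary
  \<open>e\<close>.\<close>

lemma weakly_convex_frechet_ineq:
  fixes p y :: "'a::real_inner"
  assumes wc: "weakly_convex_on \<rho> N f" and \<rho>: "0 \<le> \<rho>" and seg: "closed_segment p y \<subseteq> N"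
    and fp: "f p = ereal A" and fy: "f y = ereal B" and v: "v \<in> frechet_subdiff f p"
  shows "A + v \<bullet> (y - p) - \<rho> / 2 * (norm (y - p))\<^sup>2 \<le> B"
proof (cases "y = p")
  case True
  then show ?thesis using fp fy by simp
next
  case False
  define n where "n = norm (y - p)"
  have n: "0 < n" using False by (simp add: n_def)
  show ?thesis
  proof (rule field_le_epsilon)
    fix e :: real assume e: "0 < e"
    define \<epsilon> where "\<epsilon> = e / n"
    have \<epsilon>: "0 < \<epsilon>" using e n by (simp add: \<epsilon>_def)
    let ?Q = "\<lambda>y'. (f y' - f p - ereal (v \<bullet> (y' - p))) / ereal (norm (y' - p))"
    have "0 \<le> Liminf (at p) ?Q" using v by (simp add: frechet_subdiff_def)
    then have "\<forall>\<^sub>F y' in at p. ereal (- \<epsilon>) < ?Q y'"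
      using \<epsilon> unfolding le_Liminf_iff by simp
    moreover have "filterlim (\<lambda>t. (1 - t) *\<^sub>R p + t *\<^sub>R y) (at p) (at_right 0)"
    proof -
      have "((\<lambda>t. (1 - t) *\<^sub>R p + t *\<^sub>R y) \<longlongrightarrow> (1 - 0) *\<^sub>R p + 0 *\<^sub>R y) (at_right 0)"
        by (intro tendsto_intros)
      moreover have "\<forall>\<^sub>F t in at_right (0::real). (1 - t) *\<^sub>R p + t *\<^sub>R y \<noteq> p"
        using eventually_at_right_less[of 0]
      proof eventually_elim
        case (elim t)
        have "(1 - t) *\<^sub>R p + t *\<^sub>R y - p = t *\<^sub>R (y - p)" by (simp add: algebra_simps)
        moreover have "t *\<^sub>R (y - p) \<noteq> 0" using elim False by simp
        ultimately show ?case by (metis right_minus_eq)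
      qed
      ultimately show ?thesis by (simp add: filterlim_at)
    qed
    ultimately have "\<forall>\<^sub>F t in at_right 0. ereal (- \<epsilon>) < ?Q ((1 - t) *\<^sub>R p + t *\<^sub>R y)"
      by (rule eventually_compose_filterlim)
    moreover have "\<forall>\<^sub>F t in at_right (0::real). 0 < t \<and> t < 1"
      using eventually_at_right_real[of 0 "1::real"] by simp
    \<comment> \<open>A single small \<open>t\<close> is enough: after cancellation the remaining
      factor \<open>1 - t\<close> is simply bounded by 1, so no limit in \<open>t\<close> is
      taken.\<close>
    ultimately obtain t where t: "0 < t" "t < 1" and Q: "ereal (- \<epsilon>) < ?Q ((1 - t) *\<^sub>R p + t *\<^sub>R y)"
      using eventually_happens'[OF trivial_limit_at_right_real, OF eventually_conj] by blast
    define yt where "yt = (1 - t) *\<^sub>R p + t *\<^sub>R y"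
    define R where "R = (1 - t) * A + t * B + \<rho> / 2 * t * (1 - t) * n\<^sup>2"
    have diff: "yt - p = t *\<^sub>R (y - p)" by (simp add: yt_def algebra_simps)
    have norm: "norm (yt - p) = t * n" using t by (simp add: diff n_def)
    have "f yt \<le> ereal R"
      using weakly_convex_on_real[OF wc seg fp fy, of t] t by (simp add: yt_def R_def n_def)
    then have "?Q yt \<le> (ereal R - f p - ereal (v \<bullet> (yt - p))) / ereal (norm (yt - p))"
      using t n by (intro ereal_divide_right_mono ereal_minus_mono) (auto simp: norm)
    also have "\<dots> = ereal ((R - A - t * (v \<bullet> (y - p))) / (t * n))"
      using t n by (simp add: fp norm) (simp add: diff)
    finally have "- \<epsilon> < (R - A - t * (v \<bullet> (y - p))) / (t * n)"
      using Q unfolding yt_def by (metis ereal_less_eq(3) less_ereal.simps(1) order.strict_trans2)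
    then have "- \<epsilon> * (t * n) < R - A - t * (v \<bullet> (y - p))"
      using t n by (simp add: pos_less_divide_eq)
    also have "\<dots> = t * (B - A + \<rho> / 2 * (1 - t) * n\<^sup>2 - v \<bullet> (y - p))"
      by (simp add: R_def algebra_simps)
    finally have "t * (- \<epsilon> * n) < t * (B - A + \<rho> / 2 * (1 - t) * n\<^sup>2 - v \<bullet> (y - p))"
      by (simp add: mult_ac)
    then have "- \<epsilon> * n < B - A + \<rho> / 2 * (1 - t) * n\<^sup>2 - v \<bullet> (y - p)"
      using t by (simp only: mult_less_cancel_left_pos)
    moreover have "\<rho> / 2 * (1 - t) * n\<^sup>2 \<le> \<rho> / 2 * 1 * n\<^sup>2"
      using \<rho> t by (intro mult_right_mono mult_left_mono) auto
    moreover have "\<epsilon> * n = e" using n by (simp add: \<epsilon>_def)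
    ultimately show "A + v \<bullet> (y - p) - \<rho> / 2 * (norm (y - p))\<^sup>2 \<le> B + e"
      by (simp add: n_def)
  qed
qed

text \<open>The Frechet inequality is applied at the approximating points and passed to the limit.
  Working in a ball keeps the segments from these points to \<open>y\<close> inside
  \<open>N\<close>.\<close>

lemma weakly_convex_limiting_ineq:
  fixes p y :: "'a::real_inner"
  assumes wc: "weakly_convex_on \<rho> N f" and \<rho>: "0 \<le> \<rho>" and ball: "ball z \<delta> \<subseteq> N"
    and p: "p \<in> ball z \<delta>" and y: "y \<in> ball z \<delta>"
    and proper: "\<And>x. f x \<noteq> -\<infinity>"
    and fp: "f p = ereal A" and fy: "f y = ereal B" and v: "v \<in> limiting_subdiff f p"
  shows "A + v \<bullet> (y - p) - \<rho> / 2 * (norm (y - p))\<^sup>2 \<le> B"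
proof -
  obtain q u where q: "q \<longlonglongrightarrow> p" "(\<lambda>n. f (q n)) \<longlonglongrightarrow> f p" "\<And>n. u n \<in> frechet_subdiff f (q n)" "u \<longlonglongrightarrow> v"
    using v unfolding limiting_subdiff_def by blast
  define g where "g = (\<lambda>n. real_of_ereal (f (q n)))"
  have fq: "f (q n) = ereal (g n)" for n
    using q(3)[of n] proper[of "q n"] by (auto simp: g_def frechet_subdiff_def edom_def ereal_real)
  have g: "g \<longlonglongrightarrow> A" using q(2) by (simp add: fq fp)
  have "\<forall>\<^sub>F n in sequentially. q n \<in> ball z \<delta>"
    using q(1) p by (metis open_ball topological_tendstoD)
  then have "\<forall>\<^sub>F n in sequentially. g n + u n \<bullet> (y - q n) - \<rho> / 2 * (norm (y - q n))\<^sup>2 \<le> B"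
  proof eventually_elim
    case (elim n)
    have "closed_segment (q n) y \<subseteq> N"
      using closed_segment_subset[OF elim y] ball by auto
    then show ?case by (rule weakly_convex_frechet_ineq[OF wc \<rho> _ fq fy q(3)])
  qed
  moreover have "(\<lambda>n. g n + u n \<bullet> (y - q n) - \<rho> / 2 * (norm (y - q n))\<^sup>2)
      \<longlonglongrightarrow> A + v \<bullet> (y - p) - \<rho> / 2 * (norm (y - p))\<^sup>2"
    by (intro tendsto_intros g q)
  ultimately show ?thesis
    using tendsto_upperbound trivial_limit_sequentially by blast
qed

section \<open>Semicontinuity, compactness and the KL inequality along sequences\<close>

lemma lower_semicont_sequentially:
  assumes lsc: "lower_semicont f" and lim: "y \<longlonglongrightarrow> z" "(\<lambda>n. f (y n)) \<longlonglongrightarrow> L"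
  shows "f z \<le> L"
proof (rule ccontr)
  assume "\<not> f z \<le> L"
  then obtain C where C: "L < C" "C < f z" by (metis dense not_le)
  have "f z \<le> Liminf (at z) f" using lsc by (simp add: lower_semicont_def)
  then have "\<forall>\<^sub>F x in at z. C < f x" using C by (simp add: le_Liminf_iff)
  \<comment> \<open>The definition controls only a punctured neighbourhood; the centre is added
    because \<open>C < f z\<close>, so the sequence may visit \<open>z\<close> itself.\<close>
  then have "\<forall>\<^sub>F x in nhds z. C < f x"
    using C unfolding eventually_at_filter by (auto elim!: eventually_mono)
  from this lim(1) have "\<forall>\<^sub>F n in sequentially. C < f (y n)"
    by (rule eventually_compose_filterlim)
  then have "C \<le> L"
    using lim(2) by (intro tendsto_lowerbound[OF lim(2)]) (auto elim: eventually_mono)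
  then show False using C by simp
qed

text \<open>Bolzano-Weierstrass: infinitely many violating indices would contain a convergent
  subsequence of violations only, so one good index on each convergent subsequence suffices. Local
  properties at cluster points thus become properties of all late iterates.\<close>

lemma eventually_if_on_convergent_subsequences:
  fixes x :: "nat \<Rightarrow> 'a::euclidean_space"
  assumes bdd: "bounded (range x)"
    and sub: "\<And>r z. strict_mono r \<Longrightarrow> (\<lambda>j. x (r j)) \<longlonglongrightarrow> z \<Longrightarrow> \<exists>j. P (r j)"
  shows "\<forall>\<^sub>F k in sequentially. P k"
proof (rule ccontr)
  assume "\<not> (\<forall>\<^sub>F k in sequentially. P k)"
  then have "infinite {k. \<not> P k}"
    by (simp add: eventually_cofinite flip: cofinite_eq_sequentially)
  then obtain s :: "nat \<Rightarrow> nat" where s: "strict_mono s" "\<And>n. s n \<in> {k. \<not> P k}"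
    using infinite_enumerate by blast
  have "bounded (range (x \<circ> s))" using bdd by (rule bounded_subset) auto
  then obtain z r where r: "strict_mono r" "((x \<circ> s) \<circ> r) \<longlonglongrightarrow> z"
    using bounded_imp_convergent_subsequence by blast
  have "\<exists>j. P ((s \<circ> r) j)"
    by (rule sub[of _ z]) (use s r strict_mono_o in \<open>auto simp: o_def\<close>)
  then show False using s(2) by auto
qed

lemma coercive_sublevel_bounded:
  assumes "coercive f"
  shows "bounded {x. f x \<le> ereal C}"
proof -
  have "\<forall>\<^sub>F x in at_infinity. ereal C < f x"
    using assms unfolding coercive_def by (rule order_tendstoD) simp
  then obtain B where B: "\<And>x. B \<le> norm x \<Longrightarrow> ereal C < f x"
    unfolding eventually_at_infinity by blast
  show ?thesis
    unfolding bounded_iff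
  proof (intro exI ballI)
    fix x assume "x \<in> {x. f x \<le> ereal C}"
    then show "norm x \<le> B" using B[of x] by (metis leD mem_Collect_eq linear)
  qed
qed

text \<open>The KL inequality is multiplied out with the explicit derivative, and the distance is
  bounded by \<open>norm v\<close>. Quantifying \<open>A\<close> and \<open>v\<close> inside the
  eventuality keeps the index threshold independent of them.\<close>

lemma KL_function_ineq:
  assumes KL: "KL_function f (\<lambda>t. c * t powr (1 - \<theta>))" and c: "0 < c" "\<theta> < 1"
    and z: "limiting_subdiff f z \<noteq> {}"
    and fz: "f z = ereal L"
    and y: "y \<longlonglongrightarrow> z" "(\<lambda>n. f (y n)) \<longlonglongrightarrow> f z"
  shows "\<forall>\<^sub>F n in sequentially. \<forall>A v. f (y n) = ereal A \<longrightarrow> L < A \<longrightarrow> v \<in> limiting_subdiff f (y n) \<longrightarrow>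
    (A - L) powr \<theta> \<le> c * (1 - \<theta>) * norm v"
proof -
  obtain \<eta> :: ereal and U where \<eta>: "0 < \<eta>" and U: "z \<in> interior U"
    and ineq: "\<And>x. x \<in> U \<Longrightarrow> f z < f x \<Longrightarrow> f x < f z + \<eta> \<Longrightarrow>
        1 \<le> ereal (deriv (\<lambda>t. c * t powr (1 - \<theta>)) (real_of_ereal (f x - f z))) * edist_zero (limiting_subdiff f x)"
    using KL z unfolding KL_function_def by blast
  have "\<forall>\<^sub>F n in sequentially. y n \<in> interior U"
    using y(1) U by (metis open_interior topological_tendstoD)
  moreover have "f z < f z + \<eta>" using \<eta> fz by (cases \<eta>) auto
  then have "\<forall>\<^sub>F n in sequentially. f (y n) < f z + \<eta>"
    by (rule order_tendstoD(2)[OF y(2)])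
  ultimately show ?thesis
  proof eventually_elim
    case (elim n)
    show ?case
    proof (intro allI impI)
      fix A v assume A: "f (y n) = ereal A" "L < A" and v: "v \<in> limiting_subdiff f (y n)"
      define t where "t = A - L"
      have t: "0 < t" using A by (simp add: t_def)
      have "((\<lambda>t. c * t powr (1 - \<theta>)) has_real_derivative c * ((1 - \<theta>) * t powr (1 - \<theta> - 1))) (at t)"
        by (intro DERIV_cmult has_real_derivative_powr t)
      then have d: "deriv (\<lambda>t. c * t powr (1 - \<theta>)) t = c * (1 - \<theta>) * t powr (-\<theta>)"
        by (simp add: DERIV_imp_deriv)
      have "1 \<le> ereal (deriv (\<lambda>t. c * t powr (1 - \<theta>)) t) * edist_zero (limiting_subdiff f (y n))"
        using ineq[of "y n"] elim A interior_subset[of U] by (auto simp: fz t_def)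
      then have 1: "1 \<le> ereal (c * (1 - \<theta>) * t powr (-\<theta>)) * edist_zero (limiting_subdiff f (y n))"
        by (simp only: d)
      have e: "edist_zero (limiting_subdiff f (y n)) \<le> ereal (norm v)" "0 \<le> edist_zero (limiting_subdiff f (y n))"
        unfolding edist_zero_def using v by (auto intro: INF_lower INF_greatest)
      have pos: "0 < c * (1 - \<theta>) * t powr (-\<theta>)" using c t by simp
      have "ereal (c * (1 - \<theta>) * t powr (-\<theta>)) * edist_zero (limiting_subdiff f (y n))
          \<le> ereal (c * (1 - \<theta>) * t powr (-\<theta>)) * ereal (norm v)"
        using pos e by (intro ereal_mult_left_mono) auto
      with 1 have "1 \<le> ereal (c * (1 - \<theta>) * t powr (-\<theta>) * norm v)"
        using order_trans by fastforce
      then have "1 \<le> c * (1 - \<theta>) * norm v * t powr (-\<theta>)"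
        by (simp add: mult_ac)
      then show "(A - L) powr \<theta> \<le> c * (1 - \<theta>) * norm v"
        using t by (simp add: powr_minus field_simps flip: t_def)
    qed
  qed
qed

section \<open>Nonmonotone descent\<close>

text \<open>Telescoping, combined with the fact that a sum of squares of nonnegative numbers is at
  most the square of their sum.\<close>

lemma square_diff_chain_le:
  fixes F d :: "nat \<Rightarrow> real"
  assumes d: "\<And>i. 0 \<le> d i" and C: "0 \<le> C"
    and step: "\<And>i. i \<ge> K \<Longrightarrow> F i - F (Suc i) \<le> C * (d i)\<^sup>2" and i: "i \<ge> K"
  shows "F i - F (i + n) \<le> C * (\<Sum>s<n. d (i + s))\<^sup>2"
proof (induction n)
  case (Suc n)
  define A B where "A = (\<Sum>s<n. d (i + s))" and "B = d (i + n)"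
  have nn: "0 \<le> A" "0 \<le> B" using d by (auto simp: A_def B_def sum_nonneg)
  have "F i - F (i + Suc n) \<le> C * A\<^sup>2 + C * B\<^sup>2"
    using Suc step[of "i + n"] i by (simp add: A_def B_def)
  also have "\<dots> = C * (A\<^sup>2 + B\<^sup>2)" by (simp add: distrib_left)
  also have "\<dots> \<le> C * (A + B)\<^sup>2"
    using nn C by (intro mult_left_mono) (auto simp: power2_sum)
  finally show ?case by (simp add: A_def B_def)
qed simp

lemma suminf_tail_antimono:
  fixes d :: "nat \<Rightarrow> real"
  assumes d: "\<And>i. 0 \<le> d i" and sd: "summable d" and "i \<le> k"
  shows "(\<Sum>j. d (k + j)) \<le> (\<Sum>j. d (i + j))"
proof -
  have s: "summable (\<lambda>j. d (n + j))" for n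
    using summable_ignore_initial_segment[OF sd, of n] by (simp add: add.commute)
  obtain p where k: "k = i + p" using \<open>i \<le> k\<close> le_Suc_ex by blast
  have "(\<Sum>j. d (i + j)) = (\<Sum>j. d (k + j)) + (\<Sum>j<p. d (i + j))"
    using suminf_split_initial_segment[OF s[of i], of p] by (simp add: k add_ac)
  moreover have "0 \<le> (\<Sum>j<p. d (i + j))" using d by (simp add: sum_nonneg)
  ultimately show ?thesis by simp
qed

text \<open>After interchanging the sums, each of the \<open>q + 1\<close> shifts contributes part
  of a tail of \<open>d\<close> starting no earlier than \<open>k - q\<close>. Bounding all finite
  subsums gives both summability and the bound on the infinite sum.\<close>

lemma windowed_bound_infsum_le:
  fixes d e :: "nat \<Rightarrow> real"
  assumes d: "\<And>i. 0 \<le> d i" and sd: "summable d" and C: "0 \<le> C"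
    and e0: "\<And>j. 0 \<le> e j"
    and e: "\<And>j. j \<ge> k \<Longrightarrow> e j \<le> C * (\<Sum>i\<le>q. d (j - i))" and k: "q \<le> k"
    and P: "P \<subseteq> {k..}"
  shows "e summable_on P" "(\<Sum>\<^sub>\<infinity>j\<in>P. e j) \<le> real (Suc q) * C * (\<Sum>j. d (k - q + j))"
proof -
  have s: "summable (\<lambda>j. d (n + j))" for n
    using summable_ignore_initial_segment[OF sd, of n] by (simp add: add.commute)
  have bound: "sum e G \<le> real (Suc q) * C * (\<Sum>j. d (k - q + j))" if G: "finite G" "G \<subseteq> P" for G
  proof -
    obtain N where N: "\<And>j. j \<in> G \<Longrightarrow> j < N"
      using G(1) by (metis finite_nat_set_iff_bounded)
    have "G \<subseteq> {k..<k + N}"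
    proof
      fix j assume j: "j \<in> G"
      then have "k \<le> j" using G P by auto
      with N[OF j] show "j \<in> {k..<k + N}" by simp
    qed
    then have "sum e G \<le> sum e {k..<k + N}"
      by (rule sum_mono2[rotated]) (use e0 in auto)
    also have "\<dots> = (\<Sum>j<N. e (k + j))"
      using sum.atLeastLessThan_shift_0[of e k "k + N"] by (simp add: atLeast0LessThan add.commute)
    also have "\<dots> \<le> (\<Sum>j<N. C * (\<Sum>i\<le>q. d (k + j - i)))"
      by (rule sum_mono) (use e in auto)
    also have "\<dots> = C * (\<Sum>i\<le>q. \<Sum>j<N. d (k + j - i))"
      by (simp add: sum_distrib_left[symmetric] sum.swap[of _ "{..q}"])
    also have "(\<Sum>i\<le>q. \<Sum>j<N. d (k + j - i)) \<le> (\<Sum>i\<le>q. \<Sum>j. d (k - q + j))"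
    proof (rule sum_mono)
      fix i assume i: "i \<in> {..q}"
      have "(\<Sum>j<N. d (k + j - i)) = (\<Sum>j<N. d (k - i + j))"
        using i k by (intro sum.cong) auto
      also have "\<dots> \<le> (\<Sum>j. d (k - i + j))"
        by (rule sum_le_suminf) (use s d in auto)
      also have "\<dots> \<le> (\<Sum>j. d (k - q + j))"
        by (rule suminf_tail_antimono[OF d sd]) (use i in auto)
      finally show "(\<Sum>j<N. d (k + j - i)) \<le> (\<Sum>j. d (k - q + j))" .
    qed
    then have "C * (\<Sum>i\<le>q. \<Sum>j<N. d (k + j - i)) \<le> C * (\<Sum>i\<le>q. \<Sum>j. d (k - q + j))"
      using C by (rule mult_left_mono)
    finally show ?thesis by (simp add: mult_ac)
  qed
  show "e summable_on P"
    by (rule nonneg_bdd_above_summable_on) (use e0 bound in \<open>auto intro!: bdd_aboveI2\<close>)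
  then show "(\<Sum>\<^sub>\<infinity>j\<in>P. e j) \<le> real (Suc q) * C * (\<Sum>j. d (k - q + j))"
    by (rule infsum_le_finite_sums) (use bound in auto)
qed

lemma tail_sum_le_infsum:
  fixes e :: "nat \<Rightarrow> real"
  assumes e0: "\<And>j. 0 \<le> e j" and s: "e summable_on {j \<in> P. j \<ge> k}"
  shows "(\<Sum>i<n. if k + i \<in> P then e (k + i) else 0) \<le> (\<Sum>\<^sub>\<infinity>j\<in>{j \<in> P. j \<ge> k}. e j)"
proof -
  have "(\<Sum>i<n. if k + i \<in> P then e (k + i) else 0) = sum (\<lambda>i. e (k + i)) {i \<in> {..<n}. k + i \<in> P}"
    by (rule sum.inter_filter[symmetric]) simp
  also have "\<dots> = sum e ((\<lambda>i. k + i) ` {i \<in> {..<n}. k + i \<in> P})"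
    by (subst sum.reindex) (auto simp: inj_on_def)
  also have "\<dots> \<le> (\<Sum>\<^sub>\<infinity>j\<in>{j \<in> P. j \<ge> k}. e j)"
    by (rule finite_sum_le_infsum[OF s]) (use e0 in auto)
  finally show ?thesis .
qed

text \<open>The real-valued core of the argument: \<open>F\<close> stands for the function values,
  \<open>M\<close> for their window maxima, \<open>d\<close> for the step lengths and
  \<open>L\<close> for the limit of \<open>M\<close>.\<close>

locale nonmonotone_descent =
  fixes F M d :: "nat \<Rightarrow> real" and L a \<theta> :: real
  assumes d_nonneg: "0 \<le> d k"
    and a_pos: "0 < a" and \<theta>: "0 < \<theta>" "\<theta> < 1"
    and M_dec: "decseq M" and M_lim: "M \<longlonglongrightarrow> L"
    and F_le_M: "F k \<le> M k"
    and descent: "F (Suc k) + a * (d k)\<^sup>2 \<le> M k"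
begin

definition r :: "nat \<Rightarrow> real" where "r k = M k - L"

lemma r_nonneg: "0 \<le> r k"
  using decseq_ge[OF M_dec M_lim] by (simp add: r_def)

lemma r_decseq: "decseq r"
  using M_dec by (simp add: r_def decseq_def)

lemma r_lim: "r \<longlonglongrightarrow> 0"
  using tendsto_diff[OF M_lim tendsto_const[of L]] by (simp add: r_def[abs_def])

lemma r_Suc_le: "r (Suc k) \<le> r k"
  using r_decseq by (simp add: decseq_def)

definition gap :: "nat \<Rightarrow> real" where "gap j = sqrt (M (Suc j) - F (Suc j))"

lemma gap_nonneg: "0 \<le> gap j"
  using F_le_M[of "Suc j"] by (simp add: gap_def)

text \<open>If the gap is small, then \<open>M\<close> decreases by at least \<open>a / 2 * d\<^sub>j\<^sup>2\<close> at this step.\<close>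

lemma step_bound:
  assumes P: "j \<in> P \<Longrightarrow> a / 2 * (d j)\<^sup>2 \<le> M (Suc j) - F (Suc j)"
    and notP: "j \<notin> P \<Longrightarrow> a / 2 * (d j)\<^sup>2 \<le> M (Suc j) - F (Suc j) \<Longrightarrow>
      a / 4 * d j powr (1 / \<theta>) \<le> M (Suc j) - L"
  shows "d j \<le> sqrt (2 / a) * (if j \<in> P then gap j else 0)
    + ((4 / a) powr \<theta> + sqrt (2 / a)) * r j powr \<theta>
    + sqrt (2 / a) / (4 * (1 - \<theta>)) * (r j powr (1 - \<theta>) - r (Suc j) powr (1 - \<theta>))"
    (is "_ \<le> ?X + ?Y + ?Z")
proof -
  have X: "0 \<le> ?X" using gap_nonneg a_pos by auto
  have Y: "0 \<le> ?Y" using a_pos by auto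
  have "r (Suc j) powr (1 - \<theta>) \<le> r j powr (1 - \<theta>)"
    using r_Suc_le r_nonneg \<theta> by (intro powr_mono2) auto
  then have Z: "0 \<le> ?Z" using a_pos \<theta> by auto
  have sq: "d j \<le> sqrt (2 / a) * sqrt t" if "a / 2 * (d j)\<^sup>2 \<le> t" for t
  proof -
    have "(d j)\<^sup>2 \<le> 2 / a * t" using that a_pos by (simp add: field_simps)
    then have "d j \<le> sqrt (2 / a * t)" by (rule real_le_rsqrt)
    then show ?thesis by (simp only: real_sqrt_mult)
  qed
  \<comment> \<open>Steps in \<open>P\<close> are paid for by \<open>gap\<close>, steps outside
    \<open>P\<close> with a large gap by \<open>r j powr \<theta>\<close>, and steps with a small
    gap by the decrease of \<open>r\<close>; the remaining summands are nonnegative.\<close>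
  consider "j \<in> P" | "j \<notin> P" "a / 2 * (d j)\<^sup>2 \<le> M (Suc j) - F (Suc j)"
    | "M (Suc j) - F (Suc j) < a / 2 * (d j)\<^sup>2" by linarith
  then show ?thesis
  proof cases
    case 1
    then have "d j \<le> ?X" using sq[OF P[OF 1]] by (simp add: gap_def)
    then show ?thesis using Y Z by linarith
  next
    case 2
    have "d j powr (1 / \<theta>) \<le> 4 / a * r (Suc j)"
      using notP[OF 2] a_pos by (simp add: r_def field_simps)
    also have "\<dots> \<le> 4 / a * r j" using r_Suc_le a_pos by (intro mult_left_mono) auto
    finally have "(d j powr (1 / \<theta>)) powr \<theta> \<le> (4 / a * r j) powr \<theta>"
      using \<theta> by (intro powr_mono2) auto
    moreover have "(d j powr (1 / \<theta>)) powr \<theta> = d j"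
      using \<theta> d_nonneg[of j] by (simp add: powr_powr)
    moreover have "(4 / a * r j) powr \<theta> = (4 / a) powr \<theta> * r j powr \<theta>"
      by (rule powr_mult)
    moreover have "0 \<le> sqrt (2 / a) * r j powr \<theta>" using a_pos by simp
    ultimately have "d j \<le> ?Y" by (simp add: distrib_right)
    then show ?thesis using X Z by linarith
  next
    case 3
    have "a / 2 * (d j)\<^sup>2 \<le> r j - r (Suc j)"
      using 3 descent[of j] by (simp add: r_def)
    then have "d j \<le> sqrt (2 / a) * sqrt (r j - r (Suc j))" by (rule sq)
    also have "\<dots> \<le> sqrt (2 / a) * (1 * r j powr \<theta> + (r j powr (1 - \<theta>) - r (Suc j) powr (1 - \<theta>)) / (4 * 1 * (1 - \<theta>)))"
      using r_nonneg r_Suc_le \<theta> a_pos by (intro mult_left_mono sqrt_diff_le) auto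
    also have "\<dots> = sqrt (2 / a) * r j powr \<theta> + ?Z" by (simp add: distrib_left)
    also have "\<dots> \<le> ?Y + ?Z" using a_pos by (simp add: distrib_right)
    finally show ?thesis using X by linarith
  qed
qed

text \<open>Summing the one-step bound from \<open>k\<close> on gives three contributions: the tail
  of gaps, a sum controlled by \<open>powr_sum_bound\<close>, and a telescoping difference. The
  resulting bound \<open>s k\<close> does not depend on the number of terms, so it yields
  summability as well as the rate.\<close>

lemma summable_steps_decay:
  assumes C: "0 < C" and q: "0 < q"
    and rec: "\<forall>\<^sub>F k in sequentially. r (k + q) powr (2 * \<theta>) \<le> C * (r k - r (k + q))"
    and P: "\<And>j. j \<in> P \<Longrightarrow> a / 2 * (d j)\<^sup>2 \<le> M (Suc j) - F (Suc j)"
    and notP: "\<And>j. j \<notin> P \<Longrightarrow> a / 2 * (d j)\<^sup>2 \<le> M (Suc j) - F (Suc j) \<Longrightarrow>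
      a / 4 * d j powr (1 / \<theta>) \<le> M (Suc j) - L"
    and gap_sum: "\<forall>\<^sub>F k in sequentially. gap summable_on {j \<in> P. j \<ge> k}"
    and gap_decay: "KL_decay \<theta> (\<lambda>k. \<Sum>\<^sub>\<infinity>j\<in>{j \<in> P. j \<ge> k}. gap j)"
  shows "summable d" "KL_decay \<theta> (\<lambda>k. \<Sum>j. d (k + j))"
proof -
  define C1 where "C1 = sqrt (2 / a)"
  define C2 where "C2 = (4 / a) powr \<theta> + sqrt (2 / a)"
  define C3 where "C3 = sqrt (2 / a) / (4 * (1 - \<theta>))"
  have pos: "0 < C1" "0 < C2" "0 < C3"
    using a_pos \<theta> by (auto simp: C1_def C2_def C3_def add_pos_pos)
  obtain K where K: "\<And>k. k \<ge> K \<Longrightarrow> r (k + q) powr (2 * \<theta>) \<le> C * (r k - r (k + q))"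
    using rec by (auto simp: eventually_sequentially)
  obtain D where D: "0 < D"
    "\<And>k n. k \<ge> K \<Longrightarrow> (\<Sum>j<n. r (k + j) powr \<theta>) \<le> D * (r k powr \<theta> + r k powr (1 - \<theta>))"
    using powr_sum_bound[OF r_decseq r_nonneg \<theta> C K] by blast
  define s where "s = (\<lambda>k. C1 * (\<Sum>\<^sub>\<infinity>j\<in>{j \<in> P. j \<ge> k}. gap j) + (C2 * D + C3) * (r k powr \<theta> + r k powr (1 - \<theta>)))"
  have "\<forall>\<^sub>F k in sequentially. \<forall>n. (\<Sum>i<n. d (k + i)) \<le> s k"
    using gap_sum eventually_ge_at_top[of K]
  proof eventually_elim
    case (elim k)
    show ?case
    proof
      fix n
      have "(\<Sum>i<n. d (k + i)) \<le> (\<Sum>i<n. C1 * (if k + i \<in> P then gap (k + i) else 0) + C2 * r (k + i) powr \<theta>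
          + C3 * (r (k + i) powr (1 - \<theta>) - r (k + Suc i) powr (1 - \<theta>)))"
        unfolding C1_def C2_def C3_def
        by (intro sum_mono) (unfold add_Suc_right, rule step_bound, (blast intro: P notP)+)
      also have "\<dots> = C1 * (\<Sum>i<n. if k + i \<in> P then gap (k + i) else 0) + C2 * (\<Sum>i<n. r (k + i) powr \<theta>)
          + C3 * (\<Sum>i<n. r (k + i) powr (1 - \<theta>) - r (k + Suc i) powr (1 - \<theta>))"
        by (simp only: sum.distrib sum_distrib_left)
      also have "(\<Sum>i<n. r (k + i) powr (1 - \<theta>) - r (k + Suc i) powr (1 - \<theta>))
          = r k powr (1 - \<theta>) - r (k + n) powr (1 - \<theta>)"
        using sum_lessThan_telescope'[of "\<lambda>i. r (k + i) powr (1 - \<theta>)" n] by simp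
      finally have "(\<Sum>i<n. d (k + i)) \<le> C1 * (\<Sum>i<n. if k + i \<in> P then gap (k + i) else 0)
          + C2 * (\<Sum>i<n. r (k + i) powr \<theta>) + C3 * (r k powr (1 - \<theta>) - r (k + n) powr (1 - \<theta>))" .
      moreover have "C1 * (\<Sum>i<n. if k + i \<in> P then gap (k + i) else 0) \<le> C1 * (\<Sum>\<^sub>\<infinity>j\<in>{j \<in> P. j \<ge> k}. gap j)"
        using pos gap_nonneg elim by (intro mult_left_mono tail_sum_le_infsum) auto
      moreover have "C2 * (\<Sum>i<n. r (k + i) powr \<theta>) \<le> C2 * (D * (r k powr \<theta> + r k powr (1 - \<theta>)))"
        using pos D elim by (intro mult_left_mono) auto
      moreover have "C3 * (r k powr (1 - \<theta>) - r (k + n) powr (1 - \<theta>)) \<le> C3 * (r k powr \<theta> + r k powr (1 - \<theta>))"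
        using pos by (intro mult_left_mono) (auto intro: order_trans[of _ "0::real"] simp: diff_le_eq)
      ultimately show "(\<Sum>i<n. d (k + i)) \<le> s k"
        by (simp add: s_def distrib_right)
    qed
  qed
  then have ev: "\<forall>\<^sub>F k in sequentially. summable (\<lambda>i. d (k + i)) \<and> (\<Sum>i. d (k + i)) \<le> s k"
  proof eventually_elim
    case (elim k)
    have "summable (\<lambda>i. d (k + i))"
      by (rule summableI_nonneg_bounded[of _ "s k"]) (use elim d_nonneg in auto)
    then show ?case using elim by (auto intro: suminf_le_const)
  qed
  then obtain k where "summable (\<lambda>i. d (k + i))"
    by (auto simp: eventually_sequentially)
  then show "summable d"
    using summable_iff_shift[of d k] by (simp add: add.commute)
  have "KL_decay \<theta> s"
    unfolding s_def
    by (intro KL_decay_add KL_decay_cmult gap_decay KL_decay_recursion[OF r_decseq r_lim q \<theta> C rec])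
      (use pos D in \<open>auto intro: add_pos_pos\<close>)
  then show "KL_decay \<theta> (\<lambda>k. \<Sum>j. d (k + j))"
    by (rule KL_decay_mono) (use ev in \<open>auto elim: eventually_mono\<close>)
qed

text \<open>The gap is a telescoping sum over a window of length at most \<open>q\<close>, which is why the one-step variation
  is all that matters.\<close>

lemma gap_decay_of_steps:
  assumes sd: "summable d" and decay: "KL_decay \<theta> (\<lambda>k. \<Sum>j. d (k + j))" and C: "0 \<le> C"
    and win: "\<And>k. \<exists>i. k - q \<le> i \<and> i \<le> k \<and> M k = F i"
    and var: "\<forall>\<^sub>F i in sequentially. F i - F (Suc i) \<le> C * (d (i - 1) + d i)\<^sup>2"
  shows "\<exists>k0. \<exists>\<gamma>>0. \<exists>\<tau>. 0 < \<tau> \<and> \<tau> < 1 \<and>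
    (\<forall>k\<ge>k0. gap summable_on {j \<in> P. j \<ge> k} \<and> (\<Sum>\<^sub>\<infinity>j\<in>{j \<in> P. j \<ge> k}. gap j) \<le> KL_rate \<theta> \<gamma> \<tau> k)"
proof -
  define p where "p = Suc q"
  obtain K where K: "\<And>i. i \<ge> K \<Longrightarrow> F i - F (Suc i) \<le> C * (d (i - 1) + d i)\<^sup>2"
    using var by (auto simp: eventually_sequentially)
  \<comment> \<open>These \<open>p + 1\<close> step lengths include every \<open>d (i + s)\<close>
    and \<open>d (i + s - 1)\<close> met when the gap is telescoped from the index realizing the
    maximum.\<close>
  define T where "T = (\<lambda>j. \<Sum>i\<le>p. d (j - i))"
  have T0: "0 \<le> T j" for j using d_nonneg by (simp add: T_def sum_nonneg)
  have dT: "d i \<le> T j" if "j - p \<le> i" "i \<le> j" for i j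
  proof -
    have "d (j - (j - i)) \<le> T j"
      unfolding T_def by (rule member_le_sum[of "j - i" _ "\<lambda>i. d (j - i)"]) (use that d_nonneg in auto)
    then show ?thesis using that by simp
  qed
  \<comment> \<open>Adding 1 keeps the constant positive also for \<open>q = 0\<close>, as scaling a
    decay bound requires.\<close>
  define C' where "C' = 2 * real q * sqrt C + 1"
  have C': "0 < C'" using C by (simp add: C'_def add_nonneg_pos)
  have gapT: "gap j \<le> C' * T j" if j: "j \<ge> K + p" for j
  proof -
    obtain i where i: "Suc j - q \<le> i" "i \<le> Suc j" "M (Suc j) = F i" using win by blast
    obtain n where n: "Suc j = i + n" using i(2) le_Suc_ex by blast
    have nq: "n \<le> q" using i n by linarith
    have iK: "i \<ge> K" "i \<ge> 1" using i j by (auto simp: p_def)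
    have S: "(\<Sum>s<n. d (i + s - 1) + d (i + s)) \<le> 2 * real q * T j"
    proof -
      have "(\<Sum>s<n. d (i + s - 1) + d (i + s)) \<le> (\<Sum>s<n. 2 * T j)"
      proof (rule sum_mono)
        fix s assume "s \<in> {..<n}"
        then have "d (i + s - 1) \<le> T j" "d (i + s) \<le> T j"
          using i n iK nq by (auto intro!: dT simp: p_def)
        then show "d (i + s - 1) + d (i + s) \<le> 2 * T j" by simp
      qed
      also have "\<dots> = real n * (2 * T j)" by simp
      also have "\<dots> \<le> real q * (2 * T j)" using nq T0 by (intro mult_right_mono) auto
      finally show ?thesis by (simp add: mult_ac)
    qed
    have S0: "0 \<le> (\<Sum>s<n. d (i + s - 1) + d (i + s))" using d_nonneg by (intro sum_nonneg) simp
    have "M (Suc j) - F (Suc j) = F i - F (i + n)" using i n by simp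
    also have "\<dots> \<le> C * (\<Sum>s<n. d (i + s - 1) + d (i + s))\<^sup>2"
      by (rule square_diff_chain_le[where d = "\<lambda>i. d (i - 1) + d i" and K = K])
        (use d_nonneg C K iK in auto)
    also have "\<dots> \<le> C * (2 * real q * T j)\<^sup>2"
      by (intro mult_left_mono power_mono S S0 C)
    finally have "gap j \<le> sqrt (C * (2 * real q * T j)\<^sup>2)"
      by (simp add: gap_def)
    also have "\<dots> = 2 * real q * sqrt C * T j"
      using T0 by (simp add: real_sqrt_mult)
    also have "\<dots> \<le> C' * T j" unfolding C'_def using T0 by (intro mult_right_mono) auto
    finally show ?thesis .
  qed
  have *: "gap summable_on {j \<in> P. j \<ge> k}"
    "(\<Sum>\<^sub>\<infinity>j\<in>{j \<in> P. j \<ge> k}. gap j) \<le> real (Suc p) * C' * (\<Sum>j. d (k - p + j))" if k: "k \<ge> K + p" for k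
    by (rule windowed_bound_infsum_le[of d C' gap k p "{j \<in> P. j \<ge> k}"];
        use d_nonneg sd C' gap_nonneg gapT k in \<open>force simp: T_def\<close>)+
  have "KL_decay \<theta> (\<lambda>k. real (Suc p) * C' * (\<Sum>j. d (k - p + j)))"
    using C' \<theta> by (intro KL_decay_cmult KL_decay_shift[OF decay, of p]) auto
  then obtain \<gamma> \<tau> K' where \<gamma>: "0 < \<gamma>" "0 < \<tau>" "\<tau> < 1"
    and K': "\<And>k. k \<ge> K' \<Longrightarrow> real (Suc p) * C' * (\<Sum>j. d (k - p + j)) \<le> KL_rate \<theta> \<gamma> \<tau> k"
    unfolding KL_decay_def eventually_sequentially by blast
  have "\<forall>k\<ge>max K' (K + p). gap summable_on {j \<in> P. j \<ge> k} \<and> (\<Sum>\<^sub>\<infinity>j\<in>{j \<in> P. j \<ge> k}. gap j) \<le> KL_rate \<theta> \<gamma> \<tau> k"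
    using * K' by (meson max.bounded_iff order_trans)
  then show ?thesis using \<gamma> by blast
qed

end

section \<open>Convergence of the iterates and the window maximum\<close>

lemma summable_steps_imp_convergent:
  fixes x :: "nat \<Rightarrow> 'a::banach"
  assumes sd: "summable (\<lambda>k. norm (x (Suc k) - x k))"
  shows "\<exists>z. x \<longlonglongrightarrow> z \<and> (\<forall>k. norm (x k - z) \<le> (\<Sum>j. norm (x (Suc (k + j)) - x (k + j))))"
proof -
  have "summable (\<lambda>k. x (Suc k) - x k)" using sd by (rule summable_norm_cancel)
  then have "(\<lambda>n. \<Sum>k<n. x (Suc k) - x k) \<longlonglongrightarrow> (\<Sum>k. x (Suc k) - x k)"
    by (rule summable_LIMSEQ)
  then have "(\<lambda>n. x n - x 0 + x 0) \<longlonglongrightarrow> (\<Sum>k. x (Suc k) - x k) + x 0"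
    by (intro tendsto_add tendsto_const) (simp only: sum_lessThan_telescope)
  then obtain z where z: "x \<longlonglongrightarrow> z" by auto
  have "norm (x k - z) \<le> (\<Sum>j. norm (x (Suc (k + j)) - x (k + j)))" for k
  proof (rule tendsto_upperbound)
    have "(\<lambda>n. x (n + k)) \<longlonglongrightarrow> z" using z by (rule LIMSEQ_ignore_initial_segment)
    then show "(\<lambda>n. norm (x k - x (n + k))) \<longlonglongrightarrow> norm (x k - z)" by (intro tendsto_intros)
    have s: "summable (\<lambda>j. norm (x (Suc (k + j)) - x (k + j)))"
      using summable_ignore_initial_segment[OF sd, of k] by (simp add: add.commute)
    have "norm (x k - x (n + k)) \<le> (\<Sum>j. norm (x (Suc (k + j)) - x (k + j)))" for n
    proof -
      have "norm (x k - x (n + k)) = norm (\<Sum>j<n. x (Suc (k + j)) - x (k + j))"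
        using sum_lessThan_telescope[of "\<lambda>j. x (k + j)" n] by (simp add: norm_minus_commute add.commute)
      also have "\<dots> \<le> (\<Sum>j<n. norm (x (Suc (k + j)) - x (k + j)))" by (rule norm_sum)
      also have "\<dots> \<le> (\<Sum>j. norm (x (Suc (k + j)) - x (k + j)))"
        by (rule sum_le_suminf[OF s]) auto
      finally show ?thesis .
    qed
    then show "\<forall>\<^sub>F n in sequentially. norm (x k - x (n + k)) \<le> (\<Sum>j. norm (x (Suc (k + j)) - x (k + j)))"
      by simp
  qed simp
  then show ?thesis using z by blast
qed

text \<open>A finite maximum is attained, so the set defining the last maximizer is nonempty and its
  \<open>Max\<close> belongs to it. The final claim connects the maximum in (H1) with the index
  function \<open>l\<close>.\<close>

lemma last_argmax_props:
  shows "k - m \<le> last_argmax f x m k" "last_argmax f x m k \<le> k"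
    and "i \<in> {k - m..k} \<Longrightarrow> f (x i) \<le> f (x (last_argmax f x m k))"
    and "(MAX j\<in>{k - m..k}. f (x j)) = f (x (last_argmax f x m k))"
proof -
  let ?S = "{j\<in>{k - m..k}. \<forall>i\<in>{k - m..k}. f (x i) \<le> f (x j)}"
  have "Max ((\<lambda>j. f (x j)) ` {k - m..k}) \<in> (\<lambda>j. f (x j)) ` {k - m..k}"
    by (rule Max_in) auto
  then obtain j where j: "(MAX j\<in>{k - m..k}. f (x j)) = f (x j)" "j \<in> {k - m..k}"
    by (rule imageE)
  have "f (x i) \<le> f (x j)" if "i \<in> {k - m..k}" for i
    unfolding j(1)[symmetric] using that by (intro Max_ge) auto
  with j(2) have "j \<in> ?S" by auto
  then have "last_argmax f x m k \<in> ?S"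
    unfolding last_argmax_def by (intro Max_in) auto
  then show 1: "k - m \<le> last_argmax f x m k" "last_argmax f x m k \<le> k"
    and 2: "i \<in> {k - m..k} \<Longrightarrow> f (x i) \<le> f (x (last_argmax f x m k))" for i
    by auto
  show "(MAX j\<in>{k - m..k}. f (x j)) = f (x (last_argmax f x m k))"
    by (rule Max_eqI) (use 1 2 in auto)
qed

text \<open>Summability is asserted next to each bound, since on divergent series
  \<open>infsum\<close> gives 0 and \<open>suminf\<close> an unspecified value. Likewise the
  \<open>convergent\<close> conjunct gives the \<open>lim\<close> in \<open>\<Phi>s\<close> its
  meaning.\<close>

theorem proposition3p10:
  fixes \<Phi> :: "'a::euclidean_space \<Rightarrow> ereal"
    and x :: "nat \<Rightarrow> 'a"
    and m :: nat
    and a b c \<theta> \<rho> :: real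
    and l :: "nat \<Rightarrow> nat"
    and \<omega> :: "'a set"
    and \<Phi>s :: ereal
    and K1 K2 K31 :: "nat set"
  assumes "proper_fun \<Phi>" and "lower_semicont \<Phi>" and "coercive \<Phi>" and "bounded_below_fun \<Phi>"
    and "a > 0" and "b > 0"
    and H1: "\<And>k. \<Phi> (x (k+1)) + ereal (a * (norm (x (k+1) - x k))\<^sup>2) \<le> (MAX j\<in>{k - m..k}. \<Phi> (x j))"
    and H2: "\<exists>w. \<forall>k. w k \<in> limiting_subdiff \<Phi> (x k) \<and> norm (w (k+1)) \<le> b * norm (x (k+1) - x k)"
    and l: "l = last_argmax \<Phi> x m"
    and \<omega>: "\<omega> = cluster_points x"
    and "0 < \<theta>" and "\<theta> < 1" and "c > 0"
    and KL: "KL_function \<Phi> (\<lambda>t. c * t powr (1 - \<theta>))"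
    and "liminf (\<lambda>k. \<Phi> (x k)) \<ge> lim (\<lambda>k. \<Phi> (x (l k)))"
    and "\<And>r z. strict_mono r \<Longrightarrow> (\<lambda>j. x (r j)) \<longlonglongrightarrow> z \<Longrightarrow> limsup (\<lambda>j. \<Phi> (x (r j))) \<le> \<Phi> z"
    and "\<rho> > 0" and "\<exists>N. \<omega> \<subseteq> interior N \<and> weakly_convex_on \<rho> N \<Phi>"
    and \<Phi>s: "\<Phi>s = lim (\<lambda>k. \<Phi> (x k))"
    and K1: "K1 = {k. \<Phi> (x (l (k+1))) - \<Phi> (x (k+1)) \<ge> ereal (a/2 * (norm (x (k+1) - x k))\<^sup>2)}"
    and K2: "K2 = {k. ereal (a/2 * (norm (x (k+1) - x k))\<^sup>2) \<le> \<Phi> (x (l (k+1))) - \<Phi> (x (k+1)) \<and>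
                      \<Phi> (x (l (k+1))) - \<Phi> (x (k+1)) < ereal (a/2 * norm (x (k+1) - x k) powr (1/\<theta>))}"
    and K31: "K31 = {k \<in> K1 - K2. \<Phi>s - \<Phi> (x (k+1)) > ereal (a/4 * norm (x (k+1) - x k) powr (1/\<theta>))}"
  shows "convergent (\<lambda>k. \<Phi> (x k)) \<and>
    ((\<exists>k0. \<exists>\<gamma>>0. \<exists>\<tau>. 0 < \<tau> \<and> \<tau> < 1 \<and>
        (\<forall>k\<ge>k0.
           (\<lambda>j. sqrt (real_of_ereal (\<Phi> (x (l (j+1))) - \<Phi> (x (j+1))))) summable_on {j \<in> K2 \<union> K31. j \<ge> k} \<and>
           (\<Sum>\<^sub>\<infinity>j\<in>{j \<in> K2 \<union> K31. j \<ge> k}. sqrt (real_of_ereal (\<Phi> (x (l (j+1))) - \<Phi> (x (j+1)))))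
             \<le> KL_rate \<theta> \<gamma> \<tau> k))
     \<longleftrightarrow>
     (\<exists>xt\<in>\<omega>. x \<longlonglongrightarrow> xt \<and>
        (\<exists>\<gamma>>0. \<exists>\<tau>. 0 < \<tau> \<and> \<tau> < 1 \<and>
           (\<forall>\<^sub>F k in sequentially.
              summable (\<lambda>j. norm (x (k+j+1) - x (k+j))) \<and>
              norm (x k - xt) \<le> (\<Sum>j. norm (x (k+j+1) - x (k+j))) \<and>
              (\<Sum>j. norm (x (k+j+1) - x (k+j))) \<le> KL_rate \<theta> \<gamma> \<tau> k))))"
proof -

  \<comment> \<open>Reduction to real sequences and convergence of the function values\<close>
  define F where "F k = real_of_ereal (\<Phi> (x k))" for k
  define M where "M k = F (l k)" for k
  define d where "d k = norm (x (k + 1) - x k)" for k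
  have proper: "\<Phi> z \<noteq> -\<infinity>" for z using assms(1) by (simp add: proper_fun_def)
  obtain w where w: "\<And>k. w k \<in> limiting_subdiff \<Phi> (x k)" and wb: "\<And>k. norm (w (k + 1)) \<le> b * d k"
    using H2 unfolding d_def by blast
  \<comment> \<open>Subgradients exist only at points of the domain, so (H2) makes every value
    finite.\<close>
  have \<Phi>F: "\<Phi> (x k) = ereal (F k)" for k
    using w[of k] proper[of "x k"] by (auto simp: F_def limiting_subdiff_def edom_def ereal_real)
  have l_bounds: "k - m \<le> l k" "l k \<le> k" for k
    unfolding l by (rule last_argmax_props)+
  have FM: "F i \<le> M k" if "i \<in> {k - m..k}" for i k
    using last_argmax_props(3)[OF that, of \<Phi> x] by (simp add: M_def l \<Phi>F)
  have d0: "0 \<le> d k" for k by (simp add: d_def)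
  have descent: "F (Suc k) + a * (d k)\<^sup>2 \<le> M k" for k
    using H1[of k] unfolding last_argmax_props(4) l[symmetric] by (simp add: M_def \<Phi>F d_def)
  have M_dec: "decseq M"
    unfolding decseq_Suc_iff
  proof
    fix k
    have "F (Suc k) \<le> M k"
    proof -
      have "0 \<le> a * (d k)\<^sup>2" using \<open>a > 0\<close> by simp
      with descent[of k] show ?thesis by linarith
    qed
    \<comment> \<open>The only index of the window at \<open>k + 1\<close> outside the window at
      \<open>k\<close> is \<open>k + 1\<close>, whose value was just bounded by
      \<open>M k\<close>.\<close>
    then have "F i \<le> M k" if "i \<in> {Suc k - m..Suc k}" for i
      using FM[of i k] that by (cases "i = Suc k") auto
    then show "M (Suc k) \<le> M k"
      using l_bounds[of "Suc k"] by (auto simp: M_def)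
  qed
  obtain B where B: "\<And>z. ereal B \<le> \<Phi> z" using assms(4) unfolding bounded_below_fun_def by blast
  have BF: "B \<le> F k" for k using B[of "x k"] by (simp add: \<Phi>F)
  obtain L where M_lim: "M \<longlonglongrightarrow> L"
    using decseq_convergent[OF M_dec, of B] BF unfolding M_def by blast
  have "lim (\<lambda>k. \<Phi> (x (l k))) = ereal L"
    by (rule limI) (use M_lim in \<open>simp add: \<Phi>F M_def[abs_def]\<close>)
  \<comment> \<open>Together with \<open>F k \<le> M k\<close> this forces the whole sequence
    \<open>F\<close>, and not only the maxima, to converge to \<open>L\<close>.\<close>
  then have inf: "ereal L \<le> liminf (\<lambda>k. ereal (F k))" using assms(15) by (simp add: \<Phi>F)
  have "limsup (\<lambda>k. ereal (F k)) \<le> limsup (\<lambda>k. ereal (M k))"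
    by (rule Limsup_mono) (use FM in auto)
  also have "\<dots> = ereal L"
    using M_lim by (intro lim_imp_Limsup) auto
  finally have sup: "limsup (\<lambda>k. ereal (F k)) \<le> ereal L" .
  have eF_lim: "(\<lambda>k. ereal (F k)) \<longlonglongrightarrow> ereal L"
  proof (rule Liminf_eq_Limsup)
    have "liminf (\<lambda>k. ereal (F k)) \<le> limsup (\<lambda>k. ereal (F k))" by (rule Liminf_le_Limsup) simp
    then show "liminf (\<lambda>k. ereal (F k)) = ereal L" "limsup (\<lambda>k. ereal (F k)) = ereal L"
      using inf sup by auto
  qed simp
  then have F_lim: "F \<longlonglongrightarrow> L" by simp
  have \<Phi>_lim: "(\<lambda>k. \<Phi> (x k)) \<longlonglongrightarrow> ereal L" using eF_lim by (simp add: \<Phi>F)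
  have \<Phi>sL: "\<Phi>s = ereal L" unfolding \<Phi>s using \<Phi>_lim by (rule limI)

  interpret nonmonotone_descent F M d L a \<theta>
    by unfold_locales (use d0 \<open>a > 0\<close> \<open>0 < \<theta>\<close> \<open>\<theta> < 1\<close> M_dec M_lim FM descent in auto)

  \<comment> \<open>Vanishing steps and cluster points\<close>
  have d_lim: "d \<longlonglongrightarrow> 0"
  proof -
    have "(\<lambda>k. (M k - F (Suc k)) / a) \<longlonglongrightarrow> (L - L) / a"
      by (intro tendsto_intros M_lim LIMSEQ_Suc F_lim) (use \<open>a > 0\<close> in simp)
    then have "(\<lambda>k. sqrt ((M k - F (Suc k)) / a)) \<longlonglongrightarrow> sqrt 0"
      by (intro tendsto_real_sqrt) simp
    moreover have "d k \<le> sqrt ((M k - F (Suc k)) / a)" for k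
      using descent[of k] \<open>a > 0\<close> by (intro real_le_rsqrt) (simp add: field_simps)
    ultimately show ?thesis
      by (intro tendsto_sandwich[of "\<lambda>_. 0" d sequentially]) (use d0 in auto)
  qed
  have w_lim: "w \<longlonglongrightarrow> 0"
  proof -
    have "(\<lambda>k. b * d k) \<longlonglongrightarrow> b * 0" by (intro tendsto_intros d_lim)
    then have "(\<lambda>k. w (Suc k)) \<longlonglongrightarrow> 0"
      by (intro Lim_null_comparison[of "\<lambda>k. w (Suc k)" "\<lambda>k. b * d k"]) (use wb in auto)
    then show ?thesis by (rule LIMSEQ_imp_Suc)
  qed
  have bdd: "bounded (range x)"
  proof (rule bounded_subset[OF coercive_sublevel_bounded[OF assms(3), of "M 0"]])
    have "F k \<le> M 0" for k using F_le_M[of k] decseqD[OF M_dec, of 0 k] by simp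
    then show "range x \<subseteq> {z. \<Phi> z \<le> ereal (M 0)}" by (auto simp: \<Phi>F)
  qed
  \<comment> \<open>Lower semicontinuity and the limsup hypothesis give the two inequalities for the
    value at \<open>z\<close>. Closedness of the subgradient graph supplies a subgradient, so that
    the KL property applies at \<open>z\<close>.\<close>
  have cluster: "\<Phi> z = ereal L \<and> (\<lambda>j. \<Phi> (x (s j))) \<longlonglongrightarrow> \<Phi> z \<and> 0 \<in> limiting_subdiff \<Phi> z \<and> z \<in> \<omega>"
    if s: "strict_mono s" and sz: "(\<lambda>j. x (s j)) \<longlonglongrightarrow> z" for s z
  proof -
    have lim: "(\<lambda>j. \<Phi> (x (s j))) \<longlonglongrightarrow> ereal L"
      using LIMSEQ_subseq_LIMSEQ[OF \<Phi>_lim s] by (simp add: o_def)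
    have "ereal L = limsup (\<lambda>j. \<Phi> (x (s j)))"
      using lim by (intro lim_imp_Limsup[symmetric]) auto
    also have "\<dots> \<le> \<Phi> z" by (rule assms(16)[OF s sz])
    finally have \<Phi>z: "\<Phi> z = ereal L"
      using lower_semicont_sequentially[OF assms(2) sz lim] by (rule antisym[rotated])
    moreover have "0 \<in> limiting_subdiff \<Phi> z"
    proof (rule limiting_subdiff_limit[of "\<lambda>j. w (s j)" _ "\<lambda>j. x (s j)"])
      show "(\<lambda>j. w (s j)) \<longlonglongrightarrow> 0"
        using LIMSEQ_subseq_LIMSEQ[OF w_lim s] by (simp add: o_def)
    qed (use w sz lim \<Phi>z in \<open>auto simp: edom_def\<close>)
    moreover have "z \<in> \<omega>" using s sz unfolding \<omega> cluster_points_def by (auto simp: o_def)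
    ultimately show ?thesis using lim by simp
  qed

  \<comment> \<open>The KL inequality along the sequence and the resulting recursion\<close>
  have KL_seq: "\<forall>\<^sub>F k in sequentially. L < F k \<longrightarrow> (F k - L) powr \<theta> \<le> c * (1 - \<theta>) * norm (w k)"
  proof (rule eventually_if_on_convergent_subsequences[OF bdd])
    fix s z assume s: "strict_mono s" "(\<lambda>j. x (s j)) \<longlonglongrightarrow> z"
    note z = cluster[OF s]
    have "\<forall>\<^sub>F n in sequentially. \<forall>A v. \<Phi> (x (s n)) = ereal A \<longrightarrow> L < A \<longrightarrow> v \<in> limiting_subdiff \<Phi> (x (s n)) \<longrightarrow>
        (A - L) powr \<theta> \<le> c * (1 - \<theta>) * norm v"
      by (rule KL_function_ineq[OF KL \<open>c > 0\<close> \<open>\<theta> < 1\<close> _ _ s(2)]) (use z in auto)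
    then obtain n where "\<forall>A v. \<Phi> (x (s n)) = ereal A \<longrightarrow> L < A \<longrightarrow> v \<in> limiting_subdiff \<Phi> (x (s n)) \<longrightarrow>
        (A - L) powr \<theta> \<le> c * (1 - \<theta>) * norm v"
      by (auto simp: eventually_sequentially)
    then show "\<exists>j. L < F (s j) \<longrightarrow> (F (s j) - L) powr \<theta> \<le> c * (1 - \<theta>) * norm (w (s j))"
      using \<Phi>F w by blast
  qed

  define Q where "Q = c * (1 - \<theta>) * b"
  have Q: "0 < Q" using \<open>c > 0\<close> \<open>\<theta> < 1\<close> \<open>b > 0\<close> by (simp add: Q_def)
  have rec: "\<forall>\<^sub>F k in sequentially. r (k + Suc m) powr (2 * \<theta>) \<le> Q\<^sup>2 / a * (r k - r (k + Suc m))"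
  proof -
    obtain K where K: "\<And>k. k \<ge> K \<Longrightarrow> L < F k \<Longrightarrow> (F k - L) powr \<theta> \<le> c * (1 - \<theta>) * norm (w k)"
      using KL_seq by (auto simp: eventually_sequentially)
    have "r (k + Suc m) powr (2 * \<theta>) \<le> Q\<^sup>2 / a * (r k - r (k + Suc m))" if k: "k \<ge> K" for k
    proof (cases "r (k + Suc m) = 0")
      case True
      then show ?thesis using r_nonneg[of k] \<open>a > 0\<close> by simp
    next
      case False
      \<comment> \<open>All indices in the window at \<open>k + Suc m\<close> are at least
        \<open>k + 1\<close>, so the maximizer has a predecessor \<open>i \<ge> k\<close>, to which
        (H1) and (H2) apply.\<close>
      define i where "i = l (k + Suc m) - 1"
      have i: "l (k + Suc m) = Suc i" "k \<le> i"
        using l_bounds(1)[of "k + Suc m"] by (auto simp: i_def)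
      have Fi: "F (Suc i) = M (k + Suc m)" using i by (simp add: M_def)
      have "L < F (Suc i)" using False r_nonneg[of "k + Suc m"] by (simp add: r_def Fi)
      then have "r (k + Suc m) powr \<theta> \<le> c * (1 - \<theta>) * norm (w (Suc i))"
        using K[of "Suc i"] i k by (simp add: r_def Fi)
      also have "\<dots> \<le> c * (1 - \<theta>) * (b * d i)"
        using wb[of i] \<open>c > 0\<close> \<open>\<theta> < 1\<close> by (intro mult_left_mono) auto
      finally have "r (k + Suc m) powr \<theta> \<le> Q * d i" by (simp add: Q_def mult_ac)
      then have "(r (k + Suc m) powr \<theta>)\<^sup>2 \<le> (Q * d i)\<^sup>2" by (intro power_mono) auto
      moreover have "(r (k + Suc m) powr \<theta>)\<^sup>2 = r (k + Suc m) powr (2 * \<theta>)"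
        by (simp add: power2_eq_square flip: powr_add)
      moreover have "(Q * d i)\<^sup>2 \<le> Q\<^sup>2 / a * (r k - r (k + Suc m))"
      proof -
        have "a * (d i)\<^sup>2 \<le> M k - F (Suc i)"
          using descent[of i] decseqD[OF M_dec i(2)] by simp
        then have "(d i)\<^sup>2 \<le> (r k - r (k + Suc m)) / a"
          using \<open>a > 0\<close> by (simp add: Fi r_def field_simps)
        then have "Q\<^sup>2 * (d i)\<^sup>2 \<le> Q\<^sup>2 * ((r k - r (k + Suc m)) / a)"
          by (rule mult_left_mono) simp
        then show ?thesis by (simp add: power_mult_distrib)
      qed
      ultimately show ?thesis by simp
    qed
    then show ?thesis by (auto simp: eventually_sequentially)
  qed

  \<comment> \<open>Weak convexity along the sequence and the one-step variation\<close>
  obtain N where N: "\<omega> \<subseteq> interior N" and wc: "weakly_convex_on \<rho> N \<Phi>" using assms(18) by blast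
  have wc_seq: "\<forall>\<^sub>F k in sequentially. F k + w k \<bullet> (x (k + 1) - x k) - \<rho> / 2 * (d k)\<^sup>2 \<le> F (k + 1)"
  proof (rule eventually_if_on_convergent_subsequences[OF bdd])
    fix s z assume s: "strict_mono s" "(\<lambda>j. x (s j)) \<longlonglongrightarrow> z"
    have "z \<in> interior N" using cluster[OF s] N by auto
    then obtain \<delta> where \<delta>: "0 < \<delta>" "ball z \<delta> \<subseteq> N" by (auto simp: mem_interior)
    \<comment> \<open>Since the steps vanish, \<open>x (s j + 1)\<close> has the same limit as
      \<open>x (s j)\<close>; eventually both lie in one ball inside \<open>N\<close>.\<close>
    have "(\<lambda>j. x (s j + 1) - x (s j)) \<longlonglongrightarrow> 0"
      using LIMSEQ_subseq_LIMSEQ[OF d_lim s(1)] by (auto simp: o_def d_def intro: tendsto_norm_zero_cancel)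
    from tendsto_add[OF this s(2)] have "(\<lambda>j. x (s j + 1)) \<longlonglongrightarrow> z" by simp
    then have "\<forall>\<^sub>F j in sequentially. x (s j + 1) \<in> ball z \<delta>"
      using \<delta>(1) by (intro topological_tendstoD) auto
    moreover have "\<forall>\<^sub>F j in sequentially. x (s j) \<in> ball z \<delta>"
      using s(2) \<delta>(1) by (intro topological_tendstoD) auto
    ultimately have "\<forall>\<^sub>F j in sequentially. x (s j + 1) \<in> ball z \<delta> \<and> x (s j) \<in> ball z \<delta>"
      by (rule eventually_conj)
    then obtain j where "x (s j + 1) \<in> ball z \<delta>" "x (s j) \<in> ball z \<delta>"
      by (auto simp: eventually_sequentially)
    then have "F (s j) + w (s j) \<bullet> (x (s j + 1) - x (s j)) - \<rho> / 2 * (norm (x (s j + 1) - x (s j)))\<^sup>2 \<le> F (s j + 1)"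
      using weakly_convex_limiting_ineq[OF wc _ \<delta>(2) _ _ proper \<Phi>F \<Phi>F w] \<open>\<rho> > 0\<close> by simp
    then show "\<exists>j. F (s j) + w (s j) \<bullet> (x (s j + 1) - x (s j)) - \<rho> / 2 * (d (s j))\<^sup>2 \<le> F (s j + 1)"
      unfolding d_def by blast
  qed
  \<comment> \<open>The subgradient term is bounded by Cauchy-Schwarz and (H2). The latter controls
    \<open>w i\<close> through the preceding step, which is why \<open>d (i - 1)\<close> appears and
    \<open>i \<ge> 1\<close> is taken.\<close>
  have var: "\<forall>\<^sub>F i in sequentially. F i - F (Suc i) \<le> (b + \<rho>) * (d (i - 1) + d i)\<^sup>2"
    using wc_seq eventually_ge_at_top[of 1]
  proof eventually_elim
    case (elim i)
    have "\<bar>w i \<bullet> (x (i + 1) - x i)\<bar> \<le> norm (w i) * d i"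
      using Cauchy_Schwarz_ineq2[of "w i"] by (simp add: d_def)
    also have "\<dots> \<le> (b * d (i - 1)) * d i"
      using wb[of "i - 1"] elim d0 by (intro mult_right_mono) auto
    finally have "F i - F (Suc i) \<le> b * (d (i - 1) * d i) + \<rho> / 2 * (d i)\<^sup>2"
      using elim(1) by simp
    also have "\<dots> \<le> b * (d (i - 1) + d i)\<^sup>2 + \<rho> * (d (i - 1) + d i)\<^sup>2"
    proof (rule add_mono)
      have nn: "0 \<le> d (i - 1) * d i" using d0 by simp
      have e: "(d (i - 1) + d i)\<^sup>2 = (d (i - 1))\<^sup>2 + (d i)\<^sup>2 + 2 * (d (i - 1) * d i)"
        by (simp add: power2_sum)
      show "b * (d (i - 1) * d i) \<le> b * (d (i - 1) + d i)\<^sup>2"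
        using nn \<open>b > 0\<close> zero_le_power2[of "d (i - 1)"] zero_le_power2[of "d i"]
        unfolding e by (intro mult_left_mono) linarith+
      show "\<rho> / 2 * (d i)\<^sup>2 \<le> \<rho> * (d (i - 1) + d i)\<^sup>2"
        using nn \<open>\<rho> > 0\<close> zero_le_power2[of "d (i - 1)"] zero_le_power2[of "d i"]
        unfolding e by (intro mult_mono) linarith+
    qed
    finally show ?case by (simp add: distrib_right)
  qed

  \<comment> \<open>The index sets in real form\<close>
  have K1': "K1 = {k. a / 2 * (d k)\<^sup>2 \<le> M (Suc k) - F (Suc k)}"
    by (simp add: K1 \<Phi>F M_def d_def)
  have K2': "K2 = {k. a / 2 * (d k)\<^sup>2 \<le> M (Suc k) - F (Suc k) \<and> M (Suc k) - F (Suc k) < a / 2 * d k powr (1 / \<theta>)}"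
    by (simp add: K2 \<Phi>F M_def d_def)
  have K31': "K31 = {k \<in> K1 - K2. a / 4 * d k powr (1 / \<theta>) < L - F (Suc k)}"
    by (simp add: K31 \<Phi>F \<Phi>sL d_def)
  define P where "P = K2 \<union> K31"
  have P: "a / 2 * (d j)\<^sup>2 \<le> M (Suc j) - F (Suc j)" if "j \<in> P" for j
    using that unfolding P_def K31' K1' K2' by auto
  \<comment> \<open>Such a step lies in \<open>K1\<close> but neither in \<open>K2\<close> nor in
    \<open>K31\<close>; subtracting the two negated strict inequalities turns \<open>a / 2\<close>
    into \<open>a / 4\<close>.\<close>
  have notP: "a / 4 * d j powr (1 / \<theta>) \<le> M (Suc j) - L"
    if "j \<notin> P" "a / 2 * (d j)\<^sup>2 \<le> M (Suc j) - F (Suc j)" for j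
  proof -
    have "a / 2 * d j powr (1 / \<theta>) \<le> M (Suc j) - F (Suc j)"
      using that unfolding P_def K2' by auto
    moreover have "L - F (Suc j) \<le> a / 4 * d j powr (1 / \<theta>)"
      using that unfolding P_def K31' K1' by auto
    ultimately show ?thesis by linarith
  qed
  have gap: "sqrt (real_of_ereal (\<Phi> (x (l (j + 1))) - \<Phi> (x (j + 1)))) = gap j" for j
    by (simp add: gap_def \<Phi>F M_def)
  have d_shift: "norm (x (k + j + 1) - x (k + j)) = d (k + j)" for k j
    by (simp add: d_def)
  have d_tail: "summable (\<lambda>j. d (k + j)) \<longleftrightarrow> summable d" for k
    using summable_iff_shift[of d k] by (simp add: add.commute)

  \<comment> \<open>Equivalence of the two rate statements\<close>
  show ?thesis
    unfolding gap d_shift d_tail P_def[symmetric]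
  proof (intro conjI iffI)
    show "convergent (\<lambda>k. \<Phi> (x k))" using \<Phi>_lim by (rule convergentI)
  next
    assume "\<exists>k0. \<exists>\<gamma>>0. \<exists>\<tau>. 0 < \<tau> \<and> \<tau> < 1 \<and> (\<forall>k\<ge>k0. gap summable_on {j \<in> P. j \<ge> k} \<and>
      (\<Sum>\<^sub>\<infinity>j\<in>{j \<in> P. j \<ge> k}. gap j) \<le> KL_rate \<theta> \<gamma> \<tau> k)"
    then obtain k0 \<gamma> \<tau> where \<gamma>: "0 < \<gamma>" "0 < \<tau>" "\<tau> < 1"
      and A: "\<And>k. k \<ge> k0 \<Longrightarrow> gap summable_on {j \<in> P. j \<ge> k}"
        "\<And>k. k \<ge> k0 \<Longrightarrow> (\<Sum>\<^sub>\<infinity>j\<in>{j \<in> P. j \<ge> k}. gap j) \<le> KL_rate \<theta> \<gamma> \<tau> k"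
      by blast
    have "KL_decay \<theta> (\<lambda>k. \<Sum>\<^sub>\<infinity>j\<in>{j \<in> P. j \<ge> k}. gap j)"
      by (rule KL_decayI[OF \<gamma>]) (use A in \<open>auto simp: eventually_sequentially\<close>)
    moreover have "\<forall>\<^sub>F k in sequentially. gap summable_on {j \<in> P. j \<ge> k}"
      using A by (auto simp: eventually_sequentially)
    moreover have "0 < Q\<^sup>2 / a" using Q \<open>a > 0\<close> by simp
    ultimately have sd: "summable d" and decay: "KL_decay \<theta> (\<lambda>k. \<Sum>j. d (k + j))"
      using summable_steps_decay[OF _ _ rec P notP] by blast+
    obtain z where z: "x \<longlonglongrightarrow> z" "\<And>k. norm (x k - z) \<le> (\<Sum>j. d (k + j))"
      using summable_steps_imp_convergent[of x] sd by (auto simp: d_def[abs_def])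
    have "z \<in> \<omega>" using cluster[of id z] z(1) by (simp add: strict_mono_id)
    moreover obtain \<gamma>' \<tau>' where "0 < \<gamma>'" "0 < \<tau>'" "\<tau>' < 1"
      "\<forall>\<^sub>F k in sequentially. (\<Sum>j. d (k + j)) \<le> KL_rate \<theta> \<gamma>' \<tau>' k"
      using decay unfolding KL_decay_def by blast
    moreover from this(4) have "\<forall>\<^sub>F k in sequentially. summable d \<and> norm (x k - z) \<le> (\<Sum>j. d (k + j)) \<and>
        (\<Sum>j. d (k + j)) \<le> KL_rate \<theta> \<gamma>' \<tau>' k"
      by eventually_elim (use sd z in simp)
    ultimately show "\<exists>xt\<in>\<omega>. x \<longlonglongrightarrow> xt \<and> (\<exists>\<gamma>>0. \<exists>\<tau>. 0 < \<tau> \<and> \<tau> < 1 \<and> (\<forall>\<^sub>F k in sequentially.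
        summable d \<and> norm (x k - xt) \<le> (\<Sum>j. d (k + j)) \<and> (\<Sum>j. d (k + j)) \<le> KL_rate \<theta> \<gamma> \<tau> k))"
      using z(1) by blast
  next
    assume "\<exists>xt\<in>\<omega>. x \<longlonglongrightarrow> xt \<and> (\<exists>\<gamma>>0. \<exists>\<tau>. 0 < \<tau> \<and> \<tau> < 1 \<and> (\<forall>\<^sub>F k in sequentially.
        summable d \<and> norm (x k - xt) \<le> (\<Sum>j. d (k + j)) \<and> (\<Sum>j. d (k + j)) \<le> KL_rate \<theta> \<gamma> \<tau> k))"
    then obtain xt \<gamma> \<tau> where \<gamma>: "0 < \<gamma>" "0 < \<tau>" "\<tau> < 1"
      and ev: "\<forall>\<^sub>F k in sequentially. summable d \<and> norm (x k - xt) \<le> (\<Sum>j. d (k + j)) \<and>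
        (\<Sum>j. d (k + j)) \<le> KL_rate \<theta> \<gamma> \<tau> k"
      by blast
    have sd: "summable d" using ev by (auto simp: eventually_sequentially)
    have decay: "KL_decay \<theta> (\<lambda>k. \<Sum>j. d (k + j))"
      by (rule KL_decayI[OF \<gamma>]) (use ev in \<open>auto elim: eventually_mono\<close>)
    have win: "\<exists>i. k - m \<le> i \<and> i \<le> k \<and> M k = F i" for k
      using l_bounds[of k] by (auto simp: M_def)
    show "\<exists>k0. \<exists>\<gamma>>0. \<exists>\<tau>. 0 < \<tau> \<and> \<tau> < 1 \<and> (\<forall>k\<ge>k0. gap summable_on {j \<in> P. j \<ge> k} \<and>
      (\<Sum>\<^sub>\<infinity>j\<in>{j \<in> P. j \<ge> k}. gap j) \<le> KL_rate \<theta> \<gamma> \<tau> k)"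
      by (rule gap_decay_of_steps[OF sd decay _ win var]) (use \<open>b > 0\<close> \<open>\<rho> > 0\<close> in simp)
  qed
qed

end
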